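(* Let $G$ be a Fuchsian group of the first kind acting on $\mathbb D$ and let $n\ge3$ be an integer. Then $$\big(\sigma^B_n\big)^{-1}(0)\cap\mathcal T_S(G)=\{\mathbb 1_{\mathbb D}\},$$ i.e. the only $f\in\mathcal T_S(G)$ with $\sigma^B_n[f]\equiv0$ is the identity function $\mathbb 1_{\mathbb D}:z\mapsto z$ on $\mathbb D$.
   Context: $\mathbb D$ is the unit disc, $\hat{\mathbb C}$ the Riemann sphere. The $B$ series of higher Schwarzians is defined, for locally injective $f$ and integers $n\ge3$, by $\sigma^B_n[f]=-2(f')^{\frac n2-1}\frac{d^{n-1}}{dz^{n-1}}\big((f')^{1-\frac n2}\big)$, with the same branch of the square root used in both places when $n$ is odd. The schlicht model of the Teichmüller space of $G$, $\mathcal T_S(G)$, is the set of schlicht (injective holomorphic) functions $f$ on $\mathbb D$ with $f(0)=0$, $f'(0)=1$, $f''(0)=0$ for which there exists an orientation-preserving quasiconformal homeomorphism $w:\hat{\mathbb C}\to\hat{\mathbb C}$ with $w|_{\mathbb D}=f$ that is compatible with $G$, i.e. $wGw^{-1}$ is again a Kleinian group (of Möbius transformations). *)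

theory Defs
  imports "HOL-Complex_Analysis.Complex_Analysis" "HOL-Algebra.Bij"
begin

section \<open>The Riemann sphere\<close>

text \<open>The sphere is the one-point compactification of the plane; \<open>None\<close> is the point at infinity.\<close>

definition riemann_sphere :: "complex option topology" where
  "riemann_sphere = topology (\<lambda>U. open {z. Some z \<in> U} \<and>
     (None \<in> U \<longrightarrow> compact (- {z. Some z \<in> U})))"

lemma openin_riemann_sphere:
  "openin riemann_sphere U \<longleftrightarrow>
     open {z. Some z \<in> U} \<and> (None \<in> U \<longrightarrow> compact (- {z. Some z \<in> U}))"
proof -
  let ?P = "\<lambda>U :: complex option set. open {z. Some z \<in> U} \<and> (None \<in> U \<longrightarrow> compact (- {z. Some z \<in> U}))"
  have "istopology ?P"
    unfolding istopology_def
  proof (rule conjI; intro allI impI)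
    fix S T assume S: "?P S" and T: "?P T"
    have "{z. Some z \<in> S \<inter> T} = {z. Some z \<in> S} \<inter> {z. Some z \<in> T}" by auto
    then show "?P (S \<inter> T)" using S T by (auto simp: compact_Un Compl_Int)
  next
    fix K assume K: "\<forall>S\<in>K. ?P S"
    have eq: "{z. Some z \<in> \<Union>K} = (\<Union>S\<in>K. {z. Some z \<in> S})" by auto
    have op: "open {z. Some z \<in> \<Union>K}" unfolding eq using K by blast
    moreover have "compact (- {z. Some z \<in> \<Union>K})" if none: "None \<in> \<Union>K"
    proof -
      obtain S where S: "S \<in> K" "None \<in> S" using none by blast
      then have c: "compact (- {z. Some z \<in> S})" using K by blast
      have "- {z. Some z \<in> \<Union>K} = - {z. Some z \<in> S} \<inter> (- {z. Some z \<in> \<Union>K})" using S by blast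
      also have "compact \<dots>" using c op by (intro compact_Int_closed) auto
      finally show ?thesis .
    qed
    ultimately show "?P (\<Union>K)" by blast
  qed
  then show ?thesis by (simp add: riemann_sphere_def topology_inverse')
qed

definition disc :: "complex option set" where
  "disc = Some ` ball 0 1"

definition sphere_inversion :: "complex option \<Rightarrow> complex option" where
  "sphere_inversion p = (case p of None \<Rightarrow> Some 0 | Some z \<Rightarrow> if z = 0 then None else Some (1 / z))"

section \<open>Moebius transformations, Kleinian and Fuchsian groups\<close>

definition moebius :: "complex \<Rightarrow> complex \<Rightarrow> complex \<Rightarrow> complex \<Rightarrow> complex option \<Rightarrow> complex option" where
  "moebius a b c d p = (case p of
       None \<Rightarrow> if c = 0 then None else Some (a / c)
     | Some z \<Rightarrow> if c * z + d = 0 then None else Some ((a * z + b) / (c * z + d)))"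

text \<open>Kleinian means discrete as a subgroup of \<open>PSL(2,\<complex>)\<close>, expressed by discreteness of the
  full preimage of the group under \<open>SL(2,\<complex>) \<rightarrow> PSL(2,\<complex>)\<close>, a set of quadruples of complex numbers.\<close>

definition kleinian_group :: "(complex option \<Rightarrow> complex option) set \<Rightarrow> bool" where
  "kleinian_group G \<longleftrightarrow>
     subgroup G (BijGroup UNIV) \<and>
     G \<subseteq> {moebius a b c d | a b c d. a * d - b * c \<noteq> 0} \<and>
     discrete {(a, b, c, d). a * d - b * c = 1 \<and> moebius a b c d \<in> G}"

definition fuchsian_group :: "(complex option \<Rightarrow> complex option) set \<Rightarrow> bool" where
  "fuchsian_group G \<longleftrightarrow> kleinian_group G \<and> (\<forall>g\<in>G. g ` disc = disc)"

definition limit_set :: "(complex option \<Rightarrow> complex option) set \<Rightarrow> complex option set" where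
  "limit_set G = (\<Union>p. riemann_sphere derived_set_of ((\<lambda>g. g p) ` G))"

definition fuchsian_first_kind :: "(complex option \<Rightarrow> complex option) set \<Rightarrow> bool" where
  "fuchsian_first_kind G \<longleftrightarrow> fuchsian_group G \<and> limit_set G = Some ` sphere 0 1"

section \<open>Quasiconformal mappings\<close>

text \<open>Absolute continuity of functions of a real variable (not to be confused with the library's
  absolute continuity of measures).\<close>

definition abs_cont_on :: "real set \<Rightarrow> (real \<Rightarrow> complex) \<Rightarrow> bool" where
  "abs_cont_on S g \<longleftrightarrow> (\<forall>\<epsilon>>0. \<exists>\<delta>>0. \<forall>\<D>.
     \<D> division_of \<Union>\<D> \<and> \<Union>\<D> \<subseteq> S \<and> (\<Sum>K\<in>\<D>. Sup K - Inf K) < \<delta> \<longrightarrow>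
     (\<Sum>K\<in>\<D>. norm (g (Sup K) - g (Inf K))) < \<epsilon>)"

text \<open>Absolute continuity on lines.\<close>

definition ACL_on :: "complex set \<Rightarrow> (complex \<Rightarrow> complex) \<Rightarrow> bool" where
  "ACL_on S f \<longleftrightarrow> (\<forall>a b. cbox a b \<subseteq> S \<longrightarrow>
     (AE y in lborel. y \<in> {Im a..Im b} \<longrightarrow> abs_cont_on {Re a..Re b} (\<lambda>x. f (Complex x y))) \<and>
     (AE x in lborel. x \<in> {Re a..Re b} \<longrightarrow> abs_cont_on {Im a..Im b} (\<lambda>y. f (Complex x y))))"

definition partial_x :: "(complex \<Rightarrow> complex) \<Rightarrow> complex \<Rightarrow> complex" where
  "partial_x f z = vector_derivative (\<lambda>x. f (Complex x (Im z))) (at (Re z))"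

definition partial_y :: "(complex \<Rightarrow> complex) \<Rightarrow> complex \<Rightarrow> complex" where
  "partial_y f z = vector_derivative (\<lambda>y. f (Complex (Re z) y)) (at (Im z))"

definition d_z :: "(complex \<Rightarrow> complex) \<Rightarrow> complex \<Rightarrow> complex" where
  "d_z f z = (partial_x f z - \<i> * partial_y f z) / 2"

definition d_zbar :: "(complex \<Rightarrow> complex) \<Rightarrow> complex \<Rightarrow> complex" where
  "d_zbar f z = (partial_x f z + \<i> * partial_y f z) / 2"

text \<open>The analytic definition of a quasiconformal mapping of a plane open set with dilatation bound
  \<open>k = (K - 1) / (K + 1)\<close>. The ACL property makes the partial derivatives exist almost everywhere.
  Bounding \<open>d_zbar f\<close> by \<open>d_z f\<close> (rather than conversely) makes the Jacobian nonnegative almost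
  everywhere: such a homeomorphism preserves orientation, so this needs no separate requirement.\<close>

definition quasiconformal_on :: "real \<Rightarrow> complex set \<Rightarrow> (complex \<Rightarrow> complex) \<Rightarrow> bool" where
  "quasiconformal_on k S f \<longleftrightarrow>
     open S \<and> (\<exists>g. homeomorphism S (f ` S) f g) \<and> ACL_on S f \<and>
     (AE z in lebesgue. z \<in> S \<longrightarrow> norm (d_zbar f z) \<le> k * norm (d_z f z))"

text \<open>On the sphere, quasiconformality is tested in the two standard charts, \<open>z\<close> and \<open>1/z\<close>
  (which are their own inverses), in the domain and in the range.\<close>

definition quasiconformal_sphere :: "(complex option \<Rightarrow> complex option) \<Rightarrow> bool" where
  "quasiconformal_sphere w \<longleftrightarrow>
     homeomorphic_map riemann_sphere riemann_sphere w \<and>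
     (\<exists>k. 0 \<le> k \<and> k < 1 \<and> (\<forall>\<phi>\<in>{id, sphere_inversion}. \<forall>\<psi>\<in>{id, sphere_inversion}.
        quasiconformal_on k {z. \<psi> (w (\<phi> (Some z))) \<noteq> None} (\<lambda>z. the (\<psi> (w (\<phi> (Some z)))))))"

section \<open>The schlicht model of the Teichmueller space\<close>

text \<open>Functions on the unit disc are represented by their extensional representatives, so that
  equality of functions is equality on the disc.\<close>

definition teich_schlicht :: "(complex option \<Rightarrow> complex option) set \<Rightarrow> (complex \<Rightarrow> complex) set" where
  "teich_schlicht G = {f \<in> extensional (ball 0 1).
     f holomorphic_on ball 0 1 \<and> inj_on f (ball 0 1) \<and>
     f 0 = 0 \<and> deriv f 0 = 1 \<and> (deriv ^^ 2) f 0 = 0 \<and>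
     (\<exists>w. quasiconformal_sphere w \<and> (\<forall>z\<in>ball 0 1. w (Some z) = Some (f z)) \<and>
          kleinian_group ((\<lambda>g. w \<circ> g \<circ> inv_into UNIV w) ` G))}"

section \<open>Higher Schwarzians of the B series\<close>

text \<open>A branch of the square root of \<open>f'\<close> near \<open>z\<close>; then
  \<open>(f')\<^bsup>n/2-1\<^esup> = h\<^bsup>n-2\<^esup>\<close> and \<open>(f')\<^bsup>1-n/2\<^esup> = h\<^bsup>2-n\<^esup>\<close>.\<close>

definition sqrt_branch :: "(complex \<Rightarrow> complex) \<Rightarrow> complex \<Rightarrow> (complex \<Rightarrow> complex) \<Rightarrow> bool" where
  "sqrt_branch f z h \<longleftrightarrow> h analytic_on {z} \<and> (\<forall>\<^sub>F u in nhds z. (h u)\<^sup>2 = deriv f u)"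

definition sigmaB :: "nat \<Rightarrow> (complex \<Rightarrow> complex) \<Rightarrow> complex \<Rightarrow> complex" where
  "sigmaB n f z = (let h = (SOME h. sqrt_branch f z h) in
     - 2 * h z powi (int n - 2) * (deriv ^^ (n - 1)) (\<lambda>u. h u powi (2 - int n)) z)"

text \<open>The choice of the branch is immaterial.\<close>

lemma sigmaB_eq:
  assumes h: "sqrt_branch f z h" and nz: "deriv f z \<noteq> 0"
  shows "sigmaB n f z = - 2 * h z powi (int n - 2) * (deriv ^^ (n - 1)) (\<lambda>u. h u powi (2 - int n)) z"
proof -
  define h' where "h' = (SOME h. sqrt_branch f z h)"
  have h': "sqrt_branch f z h'" unfolding h'_def by (rule someI[of "sqrt_branch f z", OF h])
  have sq: "(h z)\<^sup>2 = deriv f z" "(h' z)\<^sup>2 = deriv f z"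
    using h h' eventually_nhds_x_imp_x unfolding sqrt_branch_def by blast+
  then have hz: "h z \<noteq> 0" "h' z \<noteq> 0" using nz by auto
  obtain e :: complex where e: "e = 1 \<or> e = - 1" "h' z = e * h z"
    using sq by (metis mult_1 mult_minus1 power2_eq_iff)
  have e2: "e * e = 1" using e(1) by auto
  have cont: "isCont h z" "isCont h' z"
    using h h' unfolding sqrt_branch_def
    by (auto intro: analytic_at_imp_isCont)
  have avoid: "\<forall>\<^sub>F u in nhds z. g u \<noteq> 0" if "isCont g z" "g z \<noteq> 0" for g :: "complex \<Rightarrow> complex"
    using tendsto_imp_eventually_ne[OF isContD[OF that(1)] that(2)] that(2)
    by (auto simp: eventually_at_filter elim: eventually_mono)
  have "isCont (\<lambda>u. h' u + e * h u) z" using cont by (intro continuous_intros) auto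
  moreover have "h' z + e * h z \<noteq> 0" using e hz by auto
  ultimately have ev1: "\<forall>\<^sub>F u in nhds z. h' u + e * h u \<noteq> 0"
    by (rule avoid)
  have "\<forall>\<^sub>F u in nhds z. (h u)\<^sup>2 = deriv f u" "\<forall>\<^sub>F u in nhds z. (h' u)\<^sup>2 = deriv f u"
    using h h' unfolding sqrt_branch_def by auto
  with ev1 have ev: "\<forall>\<^sub>F u in nhds z. h' u = e * h u"
  proof eventually_elim
    case (elim u)
    have "(h' u + e * h u) * (h' u - e * h u) = (h' u)\<^sup>2 - (e * e) * (h u)\<^sup>2"
      by (simp add: algebra_simps power2_eq_square)
    also have "\<dots> = 0" using elim e2 by simp
    finally show ?case using elim by auto
  qed
  obtain S where S: "open S" "z \<in> S" "h holomorphic_on S"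
    using h unfolding sqrt_branch_def by (auto simp: analytic_at)
  obtain T where T: "open T" "z \<in> T" "T \<subseteq> S" "\<And>u. u \<in> T \<Longrightarrow> h u \<noteq> 0"
  proof -
    have "\<forall>\<^sub>F u in nhds z. h u \<noteq> 0"
      using cont(1) hz(1) by (rule avoid)
    then obtain T where "open T" "z \<in> T" "\<And>u. u \<in> T \<Longrightarrow> h u \<noteq> 0"
      by (auto simp: eventually_nhds)
    then show ?thesis using S by (intro that[of "T \<inter> S"]) auto
  qed
  have "(deriv ^^ (n - 1)) (\<lambda>u. h' u powi (2 - int n)) z
      = (deriv ^^ (n - 1)) (\<lambda>u. e powi (2 - int n) * h u powi (2 - int n)) z"
    using ev by (intro higher_deriv_cong_ev eventually_mono[OF ev])
      (auto simp: power_int_mult_distrib)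
  also have "\<dots> = e powi (2 - int n) * (deriv ^^ (n - 1)) (\<lambda>u. h u powi (2 - int n)) z"
    using S T by (intro higher_deriv_cmult[where A = T] holomorphic_intros)
      (auto intro: holomorphic_on_subset)
  finally have d: "(deriv ^^ (n - 1)) (\<lambda>u. h' u powi (2 - int n)) z
      = e powi (2 - int n) * (deriv ^^ (n - 1)) (\<lambda>u. h u powi (2 - int n)) z" .
  have "e powi (int n - 2) * e powi (2 - int n) = 1"
    using e(1) by (auto simp flip: power_int_add)
  then show ?thesis
    unfolding sigmaB_def h'_def[symmetric] Let_def d e(2) power_int_mult_distrib
    by (simp add: algebra_simps)
qed

end

theory Submission
  imports Defs
begin

text \<open>
  Let \<open>m = n - 2\<close>. If \<open>\<sigma>\<^sup>B\<^sub>n[f]\<close> vanishes, then \<open>(f')\<^bsup>-m/2\<^esup>\<close> is a polynomial \<open>P\<close>, so the pre-Schwarzian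
  of \<open>f\<close> is \<open>-(2/m) P'/P\<close> and the Schwarzian derivative \<open>R\<close> of \<open>f\<close> is a rational function.
  Compatibility with \<open>G\<close> says that \<open>f \<circ> g\<close> and \<open>f\<close> differ by a Moebius transformation for each \<open>g \<in> G\<close>,
  hence \<open>R(g z) = (c z + d)\<^sup>4 R(z)\<close> for \<open>g z = (a z + b)/(c z + d)\<close> of determinant 1. A nonzero
  rational function cannot satisfy this for a Fuchsian group of the first kind. Indeed, let the
  orbit of \<open>p\<close> accumulate at a point of the circle where \<open>R\<close> is finite; \<open>p\<close> may be chosen away
  from the zeros and poles of \<open>R\<close>. For the \<open>g\<close> involved, \<open>c p + d\<close> stays bounded while \<open>c\<close> is
  unbounded by discreteness, so \<open>-d/c\<close> tends to \<open>p\<close>. For generic \<open>q\<close> in the disc, \<open>g\<^sup>-\<^sup>1 q\<close> then tends to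
  \<open>p\<close> while \<open>R(g\<^sup>-\<^sup>1 q) = (a - c q)\<^sup>4 R(q)\<close> tends to infinity, a contradiction.
  Hence \<open>R = 0\<close>, and the normalization \<open>f''(0) = 0\<close> forces \<open>P\<close> to be constant.
\<close>

section \<open>Moebius transformations and discreteness\<close>

text \<open>Composition corresponds to the matrix product. The delicate inputs are infinity and the
  pole of the inner map; since its determinant is nonzero, numerator and denominator never vanish
  together there.\<close>

lemma moebius_moebius:
  assumes "a * d - b * c \<noteq> 0" "a' * d' - b' * c' \<noteq> 0"
  shows "moebius a b c d (moebius a' b' c' d' p) =
    moebius (a * a' + b * c') (a * b' + b * d') (c * a' + d * c') (c * b' + d * d') p"
proof (cases p)
  case None
  show ?thesis
  proof (cases "c' = 0")
    case True
    then have "a' \<noteq> 0" using assms(2) by auto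
    then show ?thesis using True None by (auto simp: moebius_def)
  next
    case False
    have "c * (a' / c') + d = (c * a' + d * c') / c'" "a * (a' / c') + b = (a * a' + b * c') / c'"
      using False by (auto simp: field_simps)
    then show ?thesis using False None by (auto simp: moebius_def)
  qed
next
  case (Some z)
  have eqs: "(a * a' + b * c') * z + (a * b' + b * d') = a * (a' * z + b') + b * (c' * z + d')"
    "(c * a' + d * c') * z + (c * b' + d * d') = c * (a' * z + b') + d * (c' * z + d')"
    by (auto simp: algebra_simps)
  show ?thesis
  proof (cases "c' * z + d' = 0")
    case True
    have "a' * z + b' \<noteq> 0"
    proof
      assume "a' * z + b' = 0"
      moreover have "a' * d' - b' * c' = a' * (c' * z + d') - c' * (a' * z + b')"
        by (simp add: algebra_simps)
      ultimately show False using True assms(2) by simp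
    qed
    then show ?thesis using True Some by (auto simp: moebius_def eqs)
  next
    case False
    define u where "u = a' * z + b'"
    define v where "v = c' * z + d'"
    have v: "v \<noteq> 0" using False v_def by simp
    have "c * (u / v) + d = (c * u + d * v) / v" "a * (u / v) + b = (a * u + b * v) / v"
      using v by (auto simp: field_simps)
    then show ?thesis using v unfolding Some
      by (auto simp: moebius_def eqs simp flip: u_def v_def)
  qed
qed

lemma moebius_scale:
  "k \<noteq> 0 \<Longrightarrow> moebius (a / k) (b / k) (c / k) (d / k) = moebius a b c d"
  by (rule ext) (auto simp: moebius_def add_divide_distrib[symmetric] split: option.split)

lemma moebius_id: "moebius 1 0 0 1 = id"
  by (rule ext) (auto simp: moebius_def split: option.split)

lemma moebius_inverse:
  assumes "a * d - b * c = 1"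
  shows "moebius d (-b) (-c) a \<circ> moebius a b c d = id" "moebius a b c d \<circ> moebius d (-b) (-c) a = id"
proof -
  have *: "d * a - (-b) * (-c) = 1" "a * d + b * (-c) = 1" using assms by (auto simp: algebra_simps)
  show "moebius d (-b) (-c) a \<circ> moebius a b c d = id" "moebius a b c d \<circ> moebius d (-b) (-c) a = id"
    using moebius_id * assms by (auto simp: fun_eq_iff moebius_moebius algebra_simps)
qed

text \<open>The preimage of \<open>G\<close> in SL(2), a quadruple being a matrix read row by row.
  This is the set whose discreteness defines a Kleinian group.\<close>

definition lifts :: "(complex option \<Rightarrow> complex option) set \<Rightarrow> (complex \<times> complex \<times> complex \<times> complex) set" where
  "lifts G = {(a, b, c, d). a * d - b * c = 1 \<and> moebius a b c d \<in> G}"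

lemma kleinian_group_comp:
  assumes "kleinian_group G" "g \<in> G" "h \<in> G"
  shows "g \<circ> h \<in> G"
proof -
  have s: "subgroup G (BijGroup UNIV)" using assms by (simp add: kleinian_group_def)
  then have "g \<in> Bij UNIV" "h \<in> Bij UNIV"
    using subgroup.subset[OF s] assms by (auto simp: BijGroup_def)
  then show ?thesis
    using subgroup.m_closed[OF s assms(2,3)] by (simp add: BijGroup_def compose_def comp_def restrict_def)
qed

lemma kleinian_group_inv:
  assumes "kleinian_group G" "g \<in> G"
  shows "bij g" "inv_into UNIV g \<in> G"
proof -
  have s: "subgroup G (BijGroup UNIV)" using assms by (simp add: kleinian_group_def)
  then have g: "g \<in> Bij UNIV"
    using subgroup.subset[OF s] assms by (auto simp: BijGroup_def)
  then show "bij g" by (simp add: Bij_def)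
  show "inv_into UNIV g \<in> G" using subgroup.m_inv_closed[OF s assms(2)] inv_BijGroup[OF g] by (simp add: restrict_def)
qed

text \<open>Dividing all coefficients by a square root of the determinant normalizes it to
  1.\<close>

lemma obtain_lift:
  assumes "kleinian_group G" "g \<in> G"
  obtains a b c d where "(a, b, c, d) \<in> lifts G" "g = moebius a b c d"
proof -
  obtain a b c d where g: "g = moebius a b c d" and nz: "a * d - b * c \<noteq> 0"
    using assms unfolding kleinian_group_def by blast
  define k where "k = csqrt (a * d - b * c)"
  have k: "k * k = a * d - b * c" "k \<noteq> 0"
    using nz by (auto simp: k_def simp flip: power2_eq_square)
  have "(a / k) * (d / k) - (b / k) * (c / k) = (a * d - b * c) / (k * k)"
    by (simp add: diff_divide_distrib)
  also have "\<dots> = 1" using k nz by simp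
  finally show ?thesis
    using that[of "a / k" "b / k" "c / k" "d / k"] assms(2) k(2) g
    by (simp add: lifts_def moebius_scale)
qed

text \<open>The quadruple is the product of the first matrix with the inverse of the second, the
  inverse being the adjugate in determinant 1.\<close>

lemma lifts_mult_inverse:
  assumes G: "kleinian_group G" and "(a, b, c, d) \<in> lifts G" "(a', b', c', d') \<in> lifts G"
  shows "(a * d' - b * c', b * a' - a * b', c * d' - d * c', d * a' - c * b') \<in> lifts G"
proof -
  have m: "moebius a b c d \<in> G" "moebius a' b' c' d' \<in> G"
    and det: "a * d - b * c = 1" "a' * d' - b' * c' = 1"
    using assms by (auto simp: lifts_def)
  have "inv_into UNIV (moebius a' b' c' d') = moebius d' (-b') (-c') a'"
    using moebius_inverse[OF det(2)] by (intro inv_unique_comp)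
  then have "moebius a b c d \<circ> moebius d' (-b') (-c') a' \<in> G"
    using kleinian_group_comp[OF G] kleinian_group_inv[OF G] m by metis
  moreover have "moebius a b c d \<circ> moebius d' (-b') (-c') a' =
      moebius (a * d' - b * c') (b * a' - a * b') (c * d' - d * c') (d * a' - c * b')"
    using det by (auto simp: fun_eq_iff moebius_moebius algebra_simps)
  moreover have "(a * d' - b * c') * (d * a' - c * b') - (b * a' - a * b') * (c * d' - d * c')
      = (a * d - b * c) * (a' * d' - b' * c')"
    by (simp add: algebra_simps)
  ultimately show ?thesis using det by (simp add: lifts_def)
qed

text \<open>An infinite bounded set would accumulate at some matrix \<open>l\<close>. For distinct
  \<open>x\<close>, \<open>y\<close> in the set close to \<open>l\<close>, the product of
  \<open>x\<close> with the inverse of \<open>y\<close> is a lift close to the identity, hence equal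
  to it by discreteness, and \<open>x = y\<close>.\<close>

lemma finite_bounded_lifts:
  assumes G: "kleinian_group G" and S: "S \<subseteq> lifts G" "bounded S"
  shows "finite S"
proof (rule ccontr)
  assume "infinite S"
  with S(2) obtain l where l: "l islimpt S"
    using bounded_infinite_imp_islimpt[of S S] by blast
  obtain l1 l2 l3 l4 where l_eq: "l = (l1, l2, l3, l4)" by (metis prod.exhaust)
  \<comment> \<open>The determinant is continuous, so the limit \<open>l\<close> again has
    determinant 1 and is invertible.\<close>
  define D :: "complex \<times> complex \<times> complex \<times> complex \<Rightarrow> complex"
    where "D = (\<lambda>x. fst x * snd (snd (snd x)) - fst (snd x) * fst (snd (snd x)))"
  have "closed (D -` {1})"
    unfolding D_def by (intro continuous_closed_vimage continuous_intros)
  moreover have "S \<subseteq> D -` {1}" using S by (auto simp: lifts_def D_def)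
  ultimately have "l \<in> D -` {1}" using l by (meson closed_limpt islimpt_subset)
  then have detl: "l1 * l4 - l2 * l3 = 1" by (simp add: D_def l_eq)
  \<comment> \<open>\<open>q (x, y)\<close> is \<open>x\<close> times the inverse of
    \<open>y\<close>; it is continuous and maps \<open>(l, l)\<close> to the identity.\<close>
  define q :: "(complex \<times> complex \<times> complex \<times> complex) \<times> (complex \<times> complex \<times> complex \<times> complex)
      \<Rightarrow> complex \<times> complex \<times> complex \<times> complex"
    where "q = (\<lambda>((a, b, c, d), (a', b', c', d')).
      (a * d' - b * c', b * a' - a * b', c * d' - d * c', d * a' - c * b'))"
  have "lifts G \<noteq> {}" using S \<open>infinite S\<close> by auto
  then have one: "(1, 0, 0, 1) \<in> lifts G"
    using lifts_mult_inverse[OF G] by (force simp: lifts_def algebra_simps)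
  have "discrete (lifts G)" using G by (simp add: kleinian_group_def lifts_def)
  then obtain U where U: "open U" "U \<inter> lifts G = {(1, 0, 0, 1)}"
    using one by (auto simp: discrete_def isolated_in_def)
  have "open (q -` U)"
    using U(1) unfolding q_def case_prod_unfold
    by (intro continuous_open_vimage continuous_intros) auto
  moreover have "(l, l) \<in> q -` U"
    using U(2) detl by (auto simp: q_def l_eq algebra_simps)
  ultimately obtain V W where VW: "open V" "open W" "(l, l) \<in> V \<times> W" "V \<times> W \<subseteq> q -` U"
    by (rule open_prod_elim)
  have "open (V \<inter> W)" "l \<in> V \<inter> W" using VW by auto
  then have inf: "infinite (S \<inter> (V \<inter> W))"
    using l[unfolded islimpt_eq_acc_point, rule_format, of "V \<inter> W"] by (simp add: Int_commute)
  obtain x where x: "x \<in> S \<inter> (V \<inter> W)" using infinite_imp_nonempty[OF inf] by (metis ex_in_conv)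
  obtain y where y: "y \<in> S \<inter> (V \<inter> W) - {x}"
    using infinite_imp_nonempty[OF infinite_remove[OF inf, of x]] by (metis ex_in_conv)
  have xy: "x \<in> S \<inter> (V \<inter> W)" "y \<in> S \<inter> (V \<inter> W)" "x \<noteq> y" using x y by auto
  obtain a b c d a' b' c' d' where x: "x = (a, b, c, d)" and y: "y = (a', b', c', d')"
    by (cases x, cases y) auto
  have det: "a * d - b * c = 1" "a' * d' - b' * c' = 1"
    using xy S unfolding x y lifts_def by blast+
  have "(a, b, c, d) \<in> lifts G" "(a', b', c', d') \<in> lifts G" using xy S unfolding x y by blast+
  then have "q (x, y) \<in> lifts G"
    unfolding q_def x y prod.case by (rule lifts_mult_inverse[OF G])
  moreover have "q (x, y) \<in> U" using xy VW(4) by blast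
  ultimately have "q (x, y) = (1, 0, 0, 1)" using U by auto
  then have e: "a * d' - b * c' = 1" "b * a' - a * b' = 0" "c * d' - d * c' = 0" "d * a' - c * b' = 1"
    by (auto simp: q_def x y)
  \<comment> \<open>Multiplying \<open>q (x, y)\<close> by \<open>y\<close> on the right recovers
    \<open>x\<close>, so \<open>q (x, y) = 1\<close> gives \<open>x = y\<close> entry by
    entry.\<close>
  have "a * (a' * d' - b' * c') = (a * d' - b * c') * a' + (b * a' - a * b') * c'"
    "b * (a' * d' - b' * c') = (a * d' - b * c') * b' + (b * a' - a * b') * d'"
    "c * (a' * d' - b' * c') = (c * d' - d * c') * a' + (d * a' - c * b') * c'"
    "d * (a' * d' - b' * c') = (c * d' - d * c') * b' + (d * a' - c * b') * d'"
    by (simp_all add: algebra_simps)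
  then have "a = a'" "b = b'" "c = c'" "d = d'" unfolding e det by simp_all
  then show False using xy x y by simp
qed

section \<open>Topology of the sphere, disc-preserving matrices and limit points\<close>

lemma topspace_riemann_sphere [simp]: "topspace riemann_sphere = UNIV"
  using openin_subset[of riemann_sphere UNIV] by (auto simp: openin_riemann_sphere)

lemma t1_space_riemann_sphere: "t1_space riemann_sphere"
proof -
  have "openin riemann_sphere (- {x})" for x
  proof (cases x)
    case (Some a)
    have "{z. z \<noteq> a} = - {a}" by auto
    then show ?thesis using Some by (simp add: openin_riemann_sphere open_Compl)
  qed (simp add: openin_riemann_sphere)
  then show ?thesis by (simp add: t1_space_closedin_singleton closedin_def Compl_eq_Diff_UNIV)
qed

text \<open>The first two claims say that the image of \<open>z\<close> is finite and of modulus
  below 1. For the third, \<open>a / c\<close> is the image of infinity: if it lay in the disc it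
  would also be the image of a point of the disc, which the determinant forbids.\<close>

lemma disc_preserving_lift:
  assumes det: "a * d - b * c = 1" and disc: "moebius a b c d ` disc = disc"
  shows "\<And>z. norm z < 1 \<Longrightarrow> c * z + d \<noteq> 0"
    and "\<And>z. norm z < 1 \<Longrightarrow> norm (a * z + b) < norm (c * z + d)"
    and "norm c \<le> norm a"
proof -
  have im: "c * z + d \<noteq> 0 \<and> norm (a * z + b) < norm (c * z + d)" if z: "norm z < 1" for z
  proof -
    have "moebius a b c d (Some z) \<in> disc" using disc z by (auto simp: disc_def)
    then show ?thesis by (auto simp: moebius_def disc_def norm_divide divide_simps split: if_splits)
  qed
  then show "\<And>z. norm z < 1 \<Longrightarrow> c * z + d \<noteq> 0"
    "\<And>z. norm z < 1 \<Longrightarrow> norm (a * z + b) < norm (c * z + d)" by blast+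
  show "norm c \<le> norm a"
  proof (rule ccontr)
    assume "\<not> norm c \<le> norm a"
    then have c: "c \<noteq> 0" "norm (a / c) < 1" by (auto simp: norm_divide divide_simps)
    then have "Some (a / c) \<in> moebius a b c d ` disc" using disc by (auto simp: disc_def)
    then obtain z where "c * z + d \<noteq> 0" "a / c = (a * z + b) / (c * z + d)"
      by (auto simp: disc_def moebius_def split: if_splits)
    then have "a * (c * z + d) = c * (a * z + b)" using c by (simp add: field_simps)
    then show False using det by (simp add: algebra_simps)
  qed
qed

text \<open>The bottom row controls the top row: \<open>a z + b\<close> is smaller than
  \<open>c z + d\<close> in norm on the disc. The points 1/2 and -1/2 bound \<open>a\<close>, the
  point 0 bounds \<open>b\<close>.\<close>

lemma disc_preserving_lift_bound:
  assumes det: "a * d - b * c = 1" and disc: "moebius a b c d ` disc = disc"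
    and c: "norm c \<le> N" and d: "norm d \<le> K"
  shows "norm (a, b, c, d) \<le> 2 * N + 4 * K"
proof -
  note D = disc_preserving_lift(2)[OF det disc]
  have "a = (a * (1/2) + b) - (a * (-1/2) + b)" by simp
  also have "norm \<dots> \<le> norm (a * (1/2) + b) + norm (a * (-1/2) + b)" by (rule norm_triangle_ineq4)
  also have "\<dots> \<le> norm (c * (1/2) + d) + norm (c * (-1/2) + d)"
    using D[of "1/2"] D[of "-1/2"] by simp
  also have "\<dots> \<le> (norm (c * (1/2)) + norm d) + (norm (c * (-1/2)) + norm d)"
    by (intro add_mono norm_triangle_ineq)
  also have "\<dots> = norm c + 2 * norm d" by (simp add: norm_mult)
  finally have "norm a \<le> N + 2 * K" using c d by simp
  moreover have "norm b \<le> K" using D[of 0] d by simp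
  moreover have "norm (a, b, c, d) \<le> norm a + (norm b + (norm c + norm d))"
    by (meson norm_Pair_le order_trans add_left_mono)
  ultimately show ?thesis using c d by linarith
qed

text \<open>The orbit accumulating at \<open>\<zeta>\<close> may start at infinity or in
  \<open>Z\<close>. Being infinite, it contains a finite point \<open>p\<close> outside
  \<open>Z\<close>, which serves as the new base point. Infinitely many orbit points near
  \<open>\<zeta>\<close> need infinitely many matrices.\<close>

lemma limit_set_infinite_lifts:
  assumes G: "kleinian_group G" and lim: "Some \<zeta> \<in> limit_set G" and Z: "finite Z"
  obtains p where "p \<notin> Z"
    "\<And>\<epsilon>. \<epsilon> > 0 \<Longrightarrow> infinite {(a, b, c, d) \<in> lifts G. c * p + d \<noteq> 0 \<and> dist \<zeta> ((a * p + b) / (c * p + d)) < \<epsilon>}"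
proof -
  obtain p0 where "Some \<zeta> \<in> riemann_sphere derived_set_of ((\<lambda>g. g p0) ` G)"
    using lim by (auto simp: limit_set_def)
  then have inf: "infinite ((\<lambda>g. g p0) ` G \<inter> U)" if "Some \<zeta> \<in> U" "openin riemann_sphere U" for U
    using that t1_space_riemann_sphere unfolding t1_space_derived_set_of_infinite_openin by auto
  have "infinite ((\<lambda>g. g p0) ` G)"
    using inf[of UNIV] by (auto simp: openin_riemann_sphere)
  then have "\<not> (\<lambda>g. g p0) ` G \<subseteq> insert None (Some ` Z)"
    using Z finite_subset by blast
  then obtain g0 p where g0: "g0 \<in> G" "g0 p0 = Some p" "p \<notin> Z"
    by (auto simp: image_def) 
  have "infinite {(a, b, c, d) \<in> lifts G. c * p + d \<noteq> 0 \<and> dist \<zeta> ((a * p + b) / (c * p + d)) < \<epsilon>}"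
    (is "infinite ?S") if "\<epsilon> > 0" for \<epsilon>
  proof
    assume "finite ?S"
    then have fin: "finite ((\<lambda>(a, b, c, d). moebius a b c d (Some p)) ` ?S)" by (rule finite_imageI)
    have sub: "x \<in> (\<lambda>(a, b, c, d). moebius a b c d (Some p)) ` ?S"
      if x: "x \<in> (\<lambda>g. g p0) ` G \<inter> Some ` ball \<zeta> \<epsilon>" for x
    proof -
      obtain g z where g: "g \<in> G" "x = g p0" "x = Some z" "dist \<zeta> z < \<epsilon>" using x by auto
      \<comment> \<open>This element carries \<open>p\<close> to \<open>g p0\<close>, so every orbit
        point of \<open>p0\<close> is one of \<open>p\<close>.\<close>
      have "g \<circ> inv_into UNIV g0 \<in> G"
        using g g0 kleinian_group_comp[OF G] kleinian_group_inv[OF G] by blast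
      then obtain a b c d where l: "(a, b, c, d) \<in> lifts G" "g \<circ> inv_into UNIV g0 = moebius a b c d"
        using obtain_lift[OF G] by metis
      have "inv_into UNIV g0 (Some p) = p0"
        using kleinian_group_inv(1)[OF G g0(1)] g0(2) by (metis bij_is_inj inv_f_f)
      then have m: "moebius a b c d (Some p) = Some z"
        using g(2,3) by (simp add: l(2)[symmetric])
      then have "c * p + d \<noteq> 0" "(a * p + b) / (c * p + d) = z"
        by (simp_all add: moebius_def split: if_splits)
      then have "(a, b, c, d) \<in> ?S" using l(1) g(4) by blast
      then show ?thesis by (rule rev_image_eqI) (simp add: m g(3))
    qed
    have "finite ((\<lambda>g. g p0) ` G \<inter> Some ` ball \<zeta> \<epsilon>)"
      by (rule finite_subset[OF subsetI fin]) (rule sub)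
    moreover have "openin riemann_sphere (Some ` ball \<zeta> \<epsilon>)"
    proof -
      have "{z :: complex. Some z \<in> Some ` ball \<zeta> \<epsilon>} = ball \<zeta> \<epsilon>" by auto
      then show ?thesis by (auto simp: openin_riemann_sphere)
    qed
    ultimately show False using inf[of "Some ` ball \<zeta> \<epsilon>"] that by auto
  qed
  then show ?thesis by (rule that[OF g0(3)])
qed

section \<open>Automorphic rational functions of a Fuchsian group of the first kind\<close>

lemma rational_locally_bounded:
  fixes P Q :: "complex poly"
  assumes "poly Q z \<noteq> 0"
  obtains \<epsilon> M where "\<epsilon> > 0" "M > 0" "\<And>u. dist z u < \<epsilon> \<Longrightarrow> poly Q u \<noteq> 0 \<and> norm (poly P u / poly Q u) \<le> M"
proof -
  define M where "M = norm (poly P z / poly Q z) + 1"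
  have "isCont (\<lambda>u. norm (poly P u / poly Q u)) z" using assms by (intro continuous_intros) auto
  then have 1: "\<forall>\<^sub>F u in nhds z. norm (poly P u / poly Q u) < M"
    unfolding isCont_def M_def by (rule order_tendstoD(2)[OF iffD1[OF tendsto_at_iff_tendsto_nhds]]) simp
  have "isCont (poly Q) z" by (intro continuous_intros)
  then have 2: "\<forall>\<^sub>F u in nhds z. poly Q u \<noteq> 0"
    unfolding isCont_def
    by (rule tendsto_imp_eventually_ne[OF iffD1[OF tendsto_at_iff_tendsto_nhds]]) (rule assms)
  have "\<forall>\<^sub>F u in nhds z. poly Q u \<noteq> 0 \<and> norm (poly P u / poly Q u) < M"
    using 1 2 by eventually_elim auto
  then obtain \<epsilon> where "\<epsilon> > 0" "\<And>u. dist u z < \<epsilon> \<Longrightarrow> poly Q u \<noteq> 0 \<and> norm (poly P u / poly Q u) < M"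
    unfolding eventually_nhds_metric by blast
  moreover have "M > 0" unfolding M_def by (smt (verit) norm_ge_zero)
  ultimately show ?thesis using that[of \<epsilon> M] by (force simp: dist_commute)
qed

text \<open>Both sides are holomorphic off the pole \<open>-d/c\<close>, on a connected set
  containing the disc, so the identity theorem applies. The extension is what allows a base point
  \<open>p\<close> outside the disc.\<close>

lemma rational_identity_extends:
  fixes A Q :: "complex poly"
  assumes disc: "\<And>z. norm z < 1 \<Longrightarrow> c * z + d \<noteq> 0"
    and eq: "\<And>z. norm z < 1 \<Longrightarrow>
      poly A ((a * z + b) / (c * z + d)) * poly Q z = (c * z + d) ^ 4 * poly A z * poly Q ((a * z + b) / (c * z + d))"
    and z: "c * z + d \<noteq> 0"
  shows "poly A ((a * z + b) / (c * z + d)) * poly Q z = (c * z + d) ^ 4 * poly A z * poly Q ((a * z + b) / (c * z + d))"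
proof -
  let ?S = "{z. c * z + d \<noteq> 0}"
  \<comment> \<open>If \<open>c = 0\<close>, the hypothesis at 0 gives \<open>d \<noteq> 0\<close>,
    so no point is removed.\<close>
  have S: "?S = (if c = 0 then UNIV else UNIV - {- d / c})"
    using disc[of 0] by (auto simp: field_simps eq_neg_iff_add_eq_0)
  then have S': "open ?S" "connected ?S"
    by (auto intro: connected_open_delete)
  show ?thesis
  proof (rule analytic_continuation_open[of "ball 0 1" ?S "\<lambda>z. poly A ((a * z + b) / (c * z + d)) * poly Q z"
      "\<lambda>z. (c * z + d) ^ 4 * poly A z * poly Q ((a * z + b) / (c * z + d))"])
    have poly: "poly p holomorphic_on T" for p T
      by (meson field_differentiable_at_within field_differentiable_def holomorphic_on_def poly_DERIV)
    have "(\<lambda>z. (a * z + b) / (c * z + d)) holomorphic_on ?S" by (intro holomorphic_intros) auto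
    then have *: "(\<lambda>z. poly p ((a * z + b) / (c * z + d))) holomorphic_on ?S" for p
      using holomorphic_on_compose[OF _ poly] by (simp add: o_def)
    show "(\<lambda>z. poly A ((a * z + b) / (c * z + d)) * poly Q z) holomorphic_on ?S"
      "(\<lambda>z. (c * z + d) ^ 4 * poly A z * poly Q ((a * z + b) / (c * z + d))) holomorphic_on ?S"
      by (intro holomorphic_intros * poly)+
  qed (use disc eq z S' in auto)
qed

text \<open>The hypothesis is automorphy of weight 4 for \<open>A / Q\<close>, with denominators
  cleared: the quadratic differential with this coefficient is invariant under
  \<open>G\<close>.\<close>

lemma fuchsian_automorphic_rational_zero:
  fixes A Q :: "complex poly"
  assumes G: "fuchsian_first_kind G" and Q: "Q \<noteq> 0"
    and eq: "\<And>a b c d z. (a, b, c, d) \<in> lifts G \<Longrightarrow> norm z < 1 \<Longrightarrow>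
      poly A ((a * z + b) / (c * z + d)) * poly Q z = (c * z + d) ^ 4 * poly A z * poly Q ((a * z + b) / (c * z + d))"
  shows "A = 0"
proof (rule ccontr)
  assume A: "A \<noteq> 0"
  have kl: "kleinian_group G" and disc: "\<And>g. g \<in> G \<Longrightarrow> g ` disc = disc"
    and lim: "limit_set G = Some ` sphere 0 1"
    using G by (auto simp: fuchsian_first_kind_def fuchsian_group_def)
  define R where "R z = poly A z / poly Q z" for z
  define Z where "Z = {z. poly (A * Q) z = 0}"
  have Z: "finite Z" using A Q unfolding Z_def by (intro poly_roots_finite) auto
  have "infinite (sphere (0::complex) 1)"
  proof
    assume "finite (sphere (0::complex) 1)"
    moreover have "connected (sphere (0::complex) 1)" by (intro connected_sphere) auto
    ultimately have "sphere (0::complex) 1 = {} \<or> (\<exists>u. sphere (0::complex) 1 = {u})"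
      by (simp only: connected_finite_iff_sing)
    moreover have "1 \<in> sphere (0::complex) 1" "-1 \<in> sphere (0::complex) 1" by auto
    ultimately have "(1::complex) = -1" by (metis empty_iff singletonD)
    then show False by simp
  qed
  then obtain \<zeta> where \<zeta>: "\<zeta> \<in> sphere 0 1" "\<zeta> \<notin> Z"
    by (metis Z finite_subset subsetI)
  \<comment> \<open>The test point \<open>q\<close> is taken inside the disc so that, with
    \<open>norm c \<le> norm a\<close>, the quantity \<open>a - c q\<close> grows at least like
    \<open>c\<close>.\<close>
  have "infinite (ball (0::complex) 1)" using finite_imp_not_open[of "ball (0::complex) 1"] by auto
  then obtain q where "q \<in> ball 0 1" "q \<notin> Z"
    by (metis Z finite_subset subsetI)
  then have q: "norm q < 1" "q \<notin> Z" by auto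
  have zl: "Some \<zeta> \<in> limit_set G" using \<zeta> lim by simp
  obtain p where p: "p \<notin> Z"
    and inf: "\<And>\<epsilon>. \<epsilon> > 0 \<Longrightarrow> infinite {(a, b, c, d) \<in> lifts G. c * p + d \<noteq> 0 \<and> dist \<zeta> ((a * p + b) / (c * p + d)) < \<epsilon>}"
    by (rule limit_set_infinite_lifts[OF kl zl Z], rule that)
  have nz: "poly A u \<noteq> 0" "poly Q u \<noteq> 0" "R u \<noteq> 0" if "u \<notin> Z" for u
    using that by (auto simp: Z_def R_def)
  have trans: "R ((a * z + b) / (c * z + d)) = (c * z + d) ^ 4 * R z"
    if "(a, b, c, d) \<in> lifts G" "c * z + d \<noteq> 0" "poly Q z \<noteq> 0" "poly Q ((a * z + b) / (c * z + d)) \<noteq> 0" for a b c d z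
  proof -
    have "a * d - b * c = 1" "moebius a b c d ` disc = disc" using that(1) disc by (auto simp: lifts_def)
    note rational_identity_extends[OF disc_preserving_lift(1)[OF this] eq[OF that(1)] that(2)]
    then show ?thesis using that(3,4) by (simp add: R_def divide_simps)
  qed
  obtain \<epsilon> M where \<epsilon>: "\<epsilon> > 0" "M > 0" "\<And>u. dist \<zeta> u < \<epsilon> \<Longrightarrow> poly Q u \<noteq> 0 \<and> norm (R u) \<le> M"
    by (rule rational_locally_bounded[OF nz(2)[OF \<zeta>(2)], where P = A, folded R_def], rule that)
  obtain \<delta> M2 where \<delta>: "\<delta> > 0" "M2 > 0" "\<And>u. dist p u < \<delta> \<Longrightarrow> poly Q u \<noteq> 0 \<and> norm (R u) \<le> M2"
    by (rule rational_locally_bounded[OF nz(2)[OF p], where P = A, folded R_def], rule that)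
  define S where "S = {(a, b, c, d) \<in> lifts G. c * p + d \<noteq> 0 \<and> dist \<zeta> ((a * p + b) / (c * p + d)) < \<epsilon>}"
  \<comment> \<open>Automorphy at \<open>p\<close> gives
    \<open>norm (c p + d) ^ 4 \<le> M / norm (R p)\<close>. Since \<open>t \<le> t ^ 4\<close> for
    \<open>t \<ge> 1\<close>, the maximum with 1 avoids taking a fourth root.\<close>
  define K where "K = max 1 (M / norm (R p))"
  have K: "norm (c * p + d) \<le> K" if "(a, b, c, d) \<in> S" for a b c d
  proof -
    have l: "(a, b, c, d) \<in> lifts G" "c * p + d \<noteq> 0" "dist \<zeta> ((a * p + b) / (c * p + d)) < \<epsilon>"
      using that by (auto simp: S_def)
    have "norm ((c * p + d) ^ 4 * R p) \<le> M"
      using trans[OF l(1,2) nz(2)[OF p]] \<epsilon>(3)[OF l(3)] by simp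
    then have *: "norm (c * p + d) ^ 4 \<le> M / norm (R p)"
      using nz(3)[OF p] by (simp add: norm_mult norm_power field_simps)
    show ?thesis
    proof (cases "norm (c * p + d) \<le> 1")
      case False
      then have "norm (c * p + d) ^ 1 \<le> norm (c * p + d) ^ 4" by (intro power_increasing) auto
      then show ?thesis using * by (simp add: K_def)
    qed (simp add: K_def)
  qed
  define r where "r = 1 - norm q"
  have r: "r > 0" using q r_def by simp
  \<comment> \<open>For \<open>norm c > N\<close> the four entries give, in order:
    \<open>c \<noteq> 0\<close> and \<open>norm w \<ge> r\<close>; \<open>norm w > 1\<close>; the
    point \<open>z\<close> within \<open>\<delta>\<close> of \<open>p\<close>; and
    \<open>norm (R z) > M2\<close>.\<close>
  define N where "N = max 1 (max (1 / r) (max ((1 / r + K) / \<delta>) (M2 / (r * norm (R q)))))"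
  \<comment> \<open>On \<open>T\<close> both \<open>c\<close> and \<open>c p + d\<close> are
    bounded, hence so is \<open>d\<close>, and then the whole matrix. Discreteness makes
    \<open>T\<close> finite, so some matrix in \<open>S\<close> has
    \<open>norm c > N\<close>.\<close>
  have "infinite S" unfolding S_def by (rule inf[OF \<epsilon>(1)])
  moreover define T where "T = {(a, b, c, d) \<in> S. norm c \<le> N}"
  have "finite T"
    unfolding T_def
  proof (rule finite_bounded_lifts[OF kl])
    show "{(a, b, c, d) \<in> S. norm c \<le> N} \<subseteq> lifts G" by (auto simp: S_def)
    define K' where "K' = K + N * norm p"
    have "norm x \<le> 2 * N + 4 * K'" if x: "x \<in> {(a, b, c, d) \<in> S. norm c \<le> N}" for x
    proof -
      obtain a b c d where x_eq: "x = (a, b, c, d)" and l: "(a, b, c, d) \<in> S" "norm c \<le> N" using x by auto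
      have "norm d \<le> norm (c * p + d) + norm (c * p)"
        by (metis add_diff_cancel_left' norm_triangle_ineq4)
      also have "\<dots> \<le> K'" using K[OF l(1)] l(2) by (auto simp: K'_def norm_mult intro!: add_mono mult_right_mono)
      finally have "norm d \<le> K'" .
      then show ?thesis unfolding x_eq using l disc
        by (intro disc_preserving_lift_bound) (auto simp: S_def lifts_def)
    qed
    then show "bounded {(a, b, c, d) \<in> S. norm c \<le> N}" unfolding bounded_iff by blast
  qed
  ultimately obtain x where x: "x \<in> S" "x \<notin> T"
    by (metis finite_subset subsetI)
  obtain a b c d where x_eq: "x = (a, b, c, d)" by (cases x)
  have l: "(a, b, c, d) \<in> S" "norm c > N" "(a, b, c, d) \<in> lifts G" using x by (auto simp: x_eq S_def T_def)
  then have det: "a * d - b * c = 1" "moebius a b c d ` disc = disc" using disc by (auto simp: lifts_def)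
  have N: "norm c > 1" "norm c > 1 / r" "norm c > (1 / r + K) / \<delta>" "norm c > M2 / (r * norm (R q))"
    using l(2) by (auto simp: N_def)
  have c0: "c \<noteq> 0" using N(1) by auto
  \<comment> \<open>The preimage \<open>z\<close> of \<open>q\<close> under the transformation lies near its pole \<open>-d/c\<close>, hence near \<open>p\<close>,
    while \<open>R z = w\<^sup>4 R q\<close> is large.\<close>
  define w where "w = a - c * q"
  have "norm c * r \<le> norm a - norm c * norm q"
    using disc_preserving_lift(3)[OF det] by (simp add: r_def algebra_simps)
  also have "\<dots> \<le> norm w" unfolding w_def by (metis norm_mult norm_triangle_ineq2)
  finally have w: "norm c * r \<le> norm w" .
  have cr: "norm c * r > 1" using N(2) r by (simp add: field_simps)
  have w0: "w \<noteq> 0" using w cr by auto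
  define z where "z = (d * q - b) / w"
  have "c * z + d = (c * (d * q - b) + d * w) / w" using w0 by (simp add: z_def field_simps)
  also have "c * (d * q - b) + d * w = 1" using det by (simp add: w_def algebra_simps)
  finally have cz: "c * z + d = 1 / w" .
  have "a * z + b = (a * (d * q - b) + b * w) / w" using w0 by (simp add: z_def field_simps)
  also have "a * (d * q - b) + b * w = (a * d - b * c) * q" by (simp add: w_def algebra_simps)
  finally have az: "(a * z + b) / (c * z + d) = q" using cz w0 det by simp
  \<comment> \<open>Both \<open>p\<close> and \<open>z\<close> have a bounded denominator
    \<open>c u + d\<close>, so their distance is at most a constant over
    \<open>norm c\<close>.\<close>
  have "p - z = ((c * p + d) - (c * z + d)) / c" using c0 by (simp add: field_simps)
  also have "norm \<dots> \<le> (norm (c * p + d) + norm (c * z + d)) / norm c"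
    unfolding norm_divide by (intro divide_right_mono norm_triangle_ineq4) auto
  also have "\<dots> \<le> (K + 1 / r) / norm c"
  proof (intro divide_right_mono add_mono K[OF l(1)])
    have "r \<le> norm c * r" using N(1) r by simp
    then have "r \<le> norm w" using w by linarith
    then show "norm (c * z + d) \<le> 1 / r" using r by (simp add: cz norm_divide frac_le)
  qed auto
  also have "\<dots> < \<delta>" using N(3) \<delta>(1) c0 by (simp add: pos_divide_less_eq add.commute mult.commute)
  finally have pz: "dist p z < \<delta>" by (simp add: dist_norm)
  have "R q = (c * z + d) ^ 4 * R z"
    using trans[OF l(3), of z] \<delta>(3)[OF pz] nz(2)[OF q(2)] cz w0 unfolding az by simp
  then have "R z = w ^ 4 * R q" using w0 by (simp add: cz power_divide)
  then have "norm w ^ 4 * norm (R q) \<le> M2" using \<delta>(3)[OF pz] by (simp add: norm_mult norm_power)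
  moreover have "norm w ^ 1 \<le> norm w ^ 4" using w cr by (intro power_increasing) auto
  then have "norm c * r \<le> norm w ^ 4" using w by simp
  then have "norm c * r * norm (R q) \<le> norm w ^ 4 * norm (R q)" by (intro mult_right_mono) auto
  moreover have "norm c * r * norm (R q) > M2"
    using N(4) r nz(3)[OF q(2)] by (simp add: field_simps)
  ultimately show False by linarith
qed

section \<open>Schwarzian derivatives\<close>

lemma derivatives_eq_on_open:
  assumes "open S" "z \<in> S" "\<And>u. u \<in> S \<Longrightarrow> F u = H u"
    and "(F has_field_derivative F') (at z)" "(H has_field_derivative H') (at z)"
  shows "F' = H'"
  using assms DERIV_unique has_field_derivative_transform_within_open by blast

text \<open>Here \<open>N\<close> is the pre-Schwarzian f''/f' and \<open>N1 - N^2/2\<close> the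
  Schwarzian of \<open>f\<close>. The relation \<open>conj\<close> is differentiated three times,
  after which the claim is an algebraic identity. The factor of weight 4 is the inverse square of
  \<open>g'\<close>.\<close>

lemma schwarzian_moebius_equivariance:
  fixes f f1 N N1 :: "complex \<Rightarrow> complex"
  assumes S: "open S" and det: "a * d - b * c = 1"
    and f: "\<And>z. z \<in> S \<Longrightarrow> (f has_field_derivative f1 z) (at z)"
    and f1: "\<And>z. z \<in> S \<Longrightarrow> (f1 has_field_derivative f1 z * N z) (at z)"
    and N: "\<And>z. z \<in> S \<Longrightarrow> (N has_field_derivative N1 z) (at z)"
    and f1_nz: "\<And>z. z \<in> S \<Longrightarrow> f1 z \<noteq> 0"
    and g_nz: "\<And>z. z \<in> S \<Longrightarrow> c * z + d \<noteq> 0"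
    and g_in: "\<And>z. z \<in> S \<Longrightarrow> (a * z + b) / (c * z + d) \<in> S"
    and f_nz: "\<And>z. z \<in> S \<Longrightarrow> \<gamma> * f z + \<delta> \<noteq> 0"
    and conj: "\<And>z. z \<in> S \<Longrightarrow> f ((a * z + b) / (c * z + d)) = (\<alpha> * f z + \<beta>) / (\<gamma> * f z + \<delta>)"
    and z: "z \<in> S"
  defines "g \<equiv> \<lambda>z. (a * z + b) / (c * z + d)"
  shows "N1 (g z) - (N (g z))\<^sup>2 / 2 = (c * z + d) ^ 4 * (N1 z - (N z)\<^sup>2 / 2)"
proof -
  define k where "k z = c * z + d" for z
  define W where "W z = \<gamma> * f z + \<delta>" for z
  define \<Delta> where "\<Delta> = \<alpha> * \<delta> - \<beta> * \<gamma>"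
  have k: "(k has_field_derivative c) (at z)" for z
    unfolding k_def by (auto intro!: derivative_eq_intros)
  have W: "(W has_field_derivative \<gamma> * f1 z) (at z)" if "z \<in> S" for z
    unfolding W_def by (auto intro!: derivative_eq_intros f that)
  have nz: "k z \<noteq> 0" "W z \<noteq> 0" "f1 z \<noteq> 0" if "z \<in> S" for z
    using that g_nz f_nz f1_nz by (auto simp: k_def W_def)
  have gS: "g z \<in> S" if "z \<in> S" for z using g_in[OF that] by (simp add: g_def)
  have g: "(g has_field_derivative 1 / (k z)\<^sup>2) (at z)" if "z \<in> S" for z
  proof -
    have "(a * (c * z + d) - (a * z + b) * c) / (c * z + d)\<^sup>2 = 1 / (k z)\<^sup>2"
      using det by (simp add: k_def algebra_simps)
    moreover have "(g has_field_derivative (a * (c * z + d) - (a * z + b) * c) / (c * z + d)\<^sup>2) (at z)"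
      using g_nz[OF that] unfolding g_def
      by (auto intro!: derivative_eq_intros simp: power2_eq_square)
    ultimately show ?thesis by simp
  qed
  have comp: "((\<lambda>z. h (g z)) has_field_derivative h' * (1 / (k z)\<^sup>2)) (at z)"
    if "z \<in> S" "(h has_field_derivative h') (at (g z))" for h h' z
    using DERIV_chain2[OF that(2) g[OF that(1)]] .
  \<comment> \<open>First derivative of \<open>conj\<close>, cleared of denominators;
    \<open>\<Delta>\<close> is the determinant of the outer Moebius map.\<close>
  have E1: "f1 (g z) * (W z)\<^sup>2 = \<Delta> * f1 z * (k z)\<^sup>2" if z: "z \<in> S" for z
  proof -
    have "((\<lambda>z. (\<alpha> * f z + \<beta>) / W z) has_field_derivative
        ((\<alpha> * f1 z) * W z - (\<alpha> * f z + \<beta>) * (\<gamma> * f1 z)) / (W z * W z)) (at z)"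
      using nz[OF z] by (auto intro!: derivative_eq_intros f[OF z] W[OF z])
    then have "f1 (g z) * (1 / (k z)\<^sup>2) = ((\<alpha> * f1 z) * W z - (\<alpha> * f z + \<beta>) * (\<gamma> * f1 z)) / (W z * W z)"
      using derivatives_eq_on_open[OF S z _ comp[OF z f[OF gS[OF z]]]] conj
      by (auto simp: g_def W_def)
    also have "(\<alpha> * f1 z) * W z - (\<alpha> * f z + \<beta>) * (\<gamma> * f1 z) = \<Delta> * f1 z"
      by (simp add: \<Delta>_def W_def algebra_simps)
    finally show ?thesis using nz[OF z] by (simp add: field_simps power2_eq_square)
  qed
  \<comment> \<open>The logarithmic derivative of \<open>E1\<close>, obtained without logarithms:
    both sides of \<open>E1\<close> are differentiated and their nonzero common value is
    cancelled.\<close>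
  have E2: "N (g z) / (k z)\<^sup>2 + 2 * \<gamma> * f1 z / W z = N z + 2 * c / k z" if z: "z \<in> S" for z
  proof -
    have "((\<lambda>z. f1 (g z) * (W z)\<^sup>2) has_field_derivative
       f1 (g z) * N (g z) * (1 / (k z)\<^sup>2) * (W z)\<^sup>2 + f1 (g z) * (2 * W z * (\<gamma> * f1 z))) (at z)"
      by (rule derivative_eq_intros comp[OF z f1[OF gS[OF z]]] W[OF z] refl)+ (simp add: algebra_simps)
    moreover have "((\<lambda>z. \<Delta> * f1 z * (k z)\<^sup>2) has_field_derivative
       \<Delta> * (f1 z * N z) * (k z)\<^sup>2 + \<Delta> * f1 z * (2 * k z * c)) (at z)"
      by (rule derivative_eq_intros f1[OF z] k refl)+ (simp add: algebra_simps)
    ultimately have "f1 (g z) * N (g z) * (1 / (k z)\<^sup>2) * (W z)\<^sup>2 + f1 (g z) * (2 * W z * (\<gamma> * f1 z))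
        = \<Delta> * (f1 z * N z) * (k z)\<^sup>2 + \<Delta> * f1 z * (2 * k z * c)"
      by (intro derivatives_eq_on_open[OF S z E1])
    moreover have "f1 (g z) * N (g z) * (1 / (k z)\<^sup>2) * (W z)\<^sup>2 + f1 (g z) * (2 * W z * (\<gamma> * f1 z))
        = (f1 (g z) * (W z)\<^sup>2) * (N (g z) / (k z)\<^sup>2 + 2 * \<gamma> * f1 z / W z)"
      using nz[OF z] by (simp add: field_simps power2_eq_square)
    moreover have "\<Delta> * (f1 z * N z) * (k z)\<^sup>2 + \<Delta> * f1 z * (2 * k z * c)
        = (\<Delta> * f1 z * (k z)\<^sup>2) * (N z + 2 * c / k z)"
      using nz[OF z] by (simp add: field_simps power2_eq_square)
    moreover have "f1 (g z) * (W z)\<^sup>2 \<noteq> 0" using nz[OF z] nz[OF gS[OF z]] by simp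
    ultimately show ?thesis using E1[OF z] by auto
  qed
  \<comment> \<open>\<open>u\<close> and \<open>v\<close> are the logarithmic derivatives of
    \<open>W\<close> and \<open>k\<close>; \<open>X\<close> and \<open>Y\<close> are
    \<open>N\<close> and \<open>N1\<close> at \<open>g z\<close>, scaled by \<open>g'\<close> and
    its square.\<close>
  define u where "u = \<gamma> * f1 z / W z"
  define v where "v = c / k z"
  define X where "X = N (g z) / (k z)\<^sup>2"
  define Y where "Y = N1 (g z) / (k z) ^ 4"
  have k2: "((\<lambda>z. (k z)\<^sup>2) has_field_derivative 2 * k z * c) (at z)"
    by (rule derivative_eq_intros k refl)+ simp
  have f2: "((\<lambda>z. 2 * \<gamma> * f1 z) has_field_derivative 2 * \<gamma> * (f1 z * N z)) (at z)"
    by (rule DERIV_cmult f1[OF z])+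
  \<comment> \<open>The derivative of \<open>E2\<close> provides the relation \<open>D2\<close> for
    \<open>Y\<close>, while \<open>E2\<close> itself gives \<open>X\<close>. Substituting both, all
    terms in \<open>u\<close> and \<open>v\<close> cancel in \<open>Y - X^2/2\<close>.\<close>
  have "((\<lambda>z. N (g z) / (k z)\<^sup>2 + 2 * \<gamma> * f1 z / W z) has_field_derivative
     (N1 (g z) * (1 / (k z)\<^sup>2) * (k z)\<^sup>2 - N (g z) * (2 * k z * c)) / ((k z)\<^sup>2 * (k z)\<^sup>2)
     + (2 * \<gamma> * (f1 z * N z) * W z - 2 * \<gamma> * f1 z * (\<gamma> * f1 z)) / (W z * W z)) (at z)"
    by (rule DERIV_add[OF DERIV_divide[OF comp[OF z N[OF gS[OF z]]] k2] DERIV_divide[OF f2 W[OF z]]])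
      (use nz[OF z] in auto)
  moreover have "((\<lambda>z. N z + 2 * c / k z) has_field_derivative N1 z - 2 * c * c / (k z * k z)) (at z)"
    using DERIV_add[OF N[OF z] DERIV_divide[OF DERIV_const[of "2 * c"] k[of z]]] nz[OF z] by simp
  ultimately have e0: "(N1 (g z) * (1 / (k z)\<^sup>2) * (k z)\<^sup>2 - N (g z) * (2 * k z * c)) / ((k z)\<^sup>2 * (k z)\<^sup>2)
     + (2 * \<gamma> * (f1 z * N z) * W z - 2 * \<gamma> * f1 z * (\<gamma> * f1 z)) / (W z * W z) = N1 z - 2 * c * c / (k z * k z)"
    by (intro derivatives_eq_on_open[OF S z E2])
  have e1: "(N1 (g z) * (1 / (k z)\<^sup>2) * (k z)\<^sup>2 - N (g z) * (2 * k z * c)) / ((k z)\<^sup>2 * (k z)\<^sup>2) = Y - 2 * v * X"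
    using nz[OF z] by (simp add: X_def Y_def v_def field_simps power2_eq_square power4_eq_xxxx)
  have e2: "(2 * \<gamma> * (f1 z * N z) * W z - 2 * \<gamma> * f1 z * (\<gamma> * f1 z)) / (W z * W z) = 2 * u * N z - 2 * u\<^sup>2"
    using nz[OF z] by (simp add: u_def field_simps power2_eq_square)
  have e3: "2 * c * c / (k z * k z) = 2 * v\<^sup>2"
    by (simp add: v_def power2_eq_square)
  have "Y - 2 * v * X + (2 * u * N z - 2 * u\<^sup>2) = N1 z - 2 * v\<^sup>2"
    using e0 unfolding e1 e2 e3 .
  then have D2: "Y = N1 z - 2 * v\<^sup>2 + 2 * v * X - 2 * u * N z + 2 * u\<^sup>2"
    by (simp add: algebra_simps)
  have X: "X = N z + 2 * v - 2 * u"
    using E2[OF z] by (simp add: X_def u_def v_def algebra_simps)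
  have "Y - X\<^sup>2 / 2 = N1 z - (N z)\<^sup>2 / 2"
    unfolding D2 X by (simp add: power2_eq_square field_simps)
  moreover have "N1 (g z) - (N (g z))\<^sup>2 / 2 = (k z) ^ 4 * (Y - X\<^sup>2 / 2)"
    using nz[OF z] by (simp add: X_def Y_def field_simps power2_eq_square power4_eq_xxxx)
  ultimately show ?thesis by (simp add: k_def)
qed

section \<open>Functions with vanishing higher Schwarzian\<close>

lemma vanishing_higher_deriv_imp_poly:
  assumes H: "H holomorphic_on ball 0 r" and r: "r > 0"
    and z: "\<And>z. z \<in> ball 0 r \<Longrightarrow> (deriv ^^ n) H z = 0"
  obtains P where "\<And>z. z \<in> ball 0 r \<Longrightarrow> H z = poly P z"
proof
  \<comment> \<open>Taylor coefficients at 0: those of index at least \<open>n\<close> vanish, so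
    the power series, which represents \<open>H\<close> on the whole ball, is a finite sum.\<close>
  define c where "c k = (deriv ^^ k) H 0 / fact k" for k
  have c0: "c k = 0" if "k \<ge> n" for k
  proof -
    have "\<forall>\<^sub>F u in nhds 0. (deriv ^^ n) H u = 0"
      using z r by (intro eventually_nhds_in_open[THEN eventually_mono, of "ball 0 r"]) auto
    then have "(deriv ^^ (k - n)) ((deriv ^^ n) H) 0 = (deriv ^^ (k - n)) (\<lambda>_. 0) 0"
      by (intro higher_deriv_cong_ev) auto
    also have "\<dots> = 0" by (simp add: higher_deriv_const)
    also have "(deriv ^^ (k - n)) ((deriv ^^ n) H) = (deriv ^^ k) H"
      using that by (metis comp_apply funpow_add le_add_diff_inverse2)
    finally show ?thesis by (simp add: c_def)
  qed
  show "H w = poly (\<Sum>k<n. monom (c k) k) w" if "w \<in> ball 0 r" for w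
  proof -
    have "(\<lambda>k. c k * w ^ k) sums H w"
      using holomorphic_power_series[OF H that] by (simp add: c_def)
    moreover have "(\<lambda>k. c k * w ^ k) sums (\<Sum>k<n. c k * w ^ k)"
      by (rule sums_finite) (auto simp: c0)
    ultimately have "H w = (\<Sum>k<n. c k * w ^ k)" by (rule sums_unique2)
    then show ?thesis by (simp add: poly_sum poly_monom)
  qed
qed

text \<open>By injectivity \<open>f'\<close> has no zero, so it has a holomorphic square root
  \<open>h\<close> on the whole disc. As the choice of branch is immaterial, \<open>h\<close> may be
  used in \<open>sigmaB\<close>; its prefactor is nonzero, so the derivative of order
  \<open>n - 1\<close> of \<open>h powi (2 - int n)\<close> vanishes and this power is a
  polynomial.\<close>

lemma sigmaB_zero_imp_poly:
  assumes f: "f holomorphic_on ball 0 1" "inj_on f (ball 0 1)" and n: "n \<ge> 3"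
    and z: "\<And>z. z \<in> ball 0 1 \<Longrightarrow> sigmaB n f z = 0"
  obtains h P where "h holomorphic_on ball 0 1"
    "\<And>z. z \<in> ball 0 1 \<Longrightarrow> deriv f z = (h z)\<^sup>2"
    "\<And>z. z \<in> ball 0 1 \<Longrightarrow> poly P z * h z ^ (n - 2) = 1"
proof -
  have nz: "deriv f z \<noteq> 0" if "z \<in> ball 0 1" for z
    using holomorphic_injective_imp_regular[OF f(1) _ f(2) that] by simp
  have "deriv f holomorphic_on ball 0 1" using f by (intro holomorphic_deriv) auto
  moreover have "contractible (ball (0::complex) 1)" by (simp add: convex_imp_contractible)
  ultimately obtain h where h: "h holomorphic_on ball 0 1" "\<And>z. z \<in> ball 0 1 \<Longrightarrow> deriv f z = (h z)\<^sup>2"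
    using contractible_imp_holomorphic_sqrt nz by blast
  have hnz: "h z \<noteq> 0" if "z \<in> ball 0 1" for z using h(2)[OF that] nz[OF that] by auto
  define H where "H u = h u powi (2 - int n)" for u
  have "(deriv ^^ (n - 1)) H z = 0" if "z \<in> ball 0 1" for z
  proof -
    have "sqrt_branch f z h"
      unfolding sqrt_branch_def
    proof
      show "h analytic_on {z}" using h(1) that unfolding analytic_at by blast
      show "\<forall>\<^sub>F u in nhds z. (h u)\<^sup>2 = deriv f u"
        using h(2) that by (intro eventually_nhds_in_open[THEN eventually_mono, of "ball 0 1"]) auto
    qed
    then have "- 2 * h z powi (int n - 2) * (deriv ^^ (n - 1)) H z = 0"
      using sigmaB_eq[OF _ nz[OF that], of h n] z[OF that] unfolding H_def by simp
    then show ?thesis using hnz[OF that] by (simp add: power_int_not_zero)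
  qed
  moreover have "H holomorphic_on ball 0 1"
    unfolding H_def using h(1) hnz by (intro holomorphic_intros) auto
  ultimately obtain P where P: "\<And>z. z \<in> ball 0 1 \<Longrightarrow> H z = poly P z"
    using vanishing_higher_deriv_imp_poly[of H 1 "n - 1"] by auto
  have "poly P z * h z ^ (n - 2) = 1" if "z \<in> ball 0 1" for z
  proof -
    have "H z * h z ^ (n - 2) = h z powi (2 - int n) * h z powi (int n - 2)"
      using n by (simp add: H_def power_int_def nat_diff_distrib)
    also have "\<dots> = 1" using hnz[OF that] by (simp flip: power_int_add)
    finally show ?thesis using P[OF that] by simp
  qed
  then show ?thesis using that h by blast
qed

lemma pderiv_zero_of_ode:
  fixes P :: "'a :: field_char_0 poly"
  assumes ode: "P * pderiv (pderiv P) = smult \<kappa> ((pderiv P)\<^sup>2)"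
    and "poly P 0 \<noteq> 0" "poly (pderiv P) 0 = 0"
  shows "pderiv P = 0"
proof (rule ccontr)
  \<comment> \<open>Compare the orders of vanishing at 0: if \<open>P'\<close> has order \<open>k \<ge> 1\<close>, the left side has order \<open>k - 1\<close>
    and the right side \<open>2 k\<close>.\<close>
  assume nz: "pderiv P \<noteq> 0"
  then have ord: "order 0 (pderiv P) = Suc (order 0 (pderiv (pderiv P)))"
    using assms(3) by (rule order_pderiv)
  have "pderiv (pderiv P) \<noteq> 0"
  proof
    assume "pderiv (pderiv P) = 0"
    then obtain c where "pderiv P = [:c:]" by (metis pderiv_iszero)
    then show False using assms(3) nz by simp
  qed
  moreover have "P \<noteq> 0" using assms(2) by auto
  ultimately have prod: "P * pderiv (pderiv P) \<noteq> 0" by simp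
  then have "\<kappa> \<noteq> 0" using ode by auto
  have "order 0 (P * pderiv (pderiv P)) = order 0 P + order 0 (pderiv (pderiv P))"
    using prod by (rule order_mult)
  moreover have "order 0 P = 0" using assms(2) by (rule order_0I)
  moreover have "order 0 (smult \<kappa> ((pderiv P)\<^sup>2)) = 2 * order 0 (pderiv P)"
    using \<open>\<kappa> \<noteq> 0\<close> nz by (simp add: order_smult order_power_n_n power2_eq_square order_mult)
  ultimately show False using ode ord by simp
qed

text \<open>The conjugate by \<open>w\<close> lies in a Kleinian group, hence is a Moebius map. On
  the disc, which \<open>g\<close> preserves, \<open>w\<close> is \<open>f\<close>, so this map
  sends \<open>f z\<close> to \<open>f (g z)\<close>; finiteness of that value excludes a zero
  denominator.\<close>

lemma teich_schlicht_conjugation: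
  assumes G: "fuchsian_group G" and f: "f \<in> teich_schlicht G" and l: "(a, b, c, d) \<in> lifts G"
  obtains \<alpha> \<beta> \<gamma> \<delta> where "\<And>z. z \<in> ball 0 1 \<Longrightarrow> \<gamma> * f z + \<delta> \<noteq> 0"
    "\<And>z. z \<in> ball 0 1 \<Longrightarrow> f ((a * z + b) / (c * z + d)) = (\<alpha> * f z + \<beta>) / (\<gamma> * f z + \<delta>)"
proof -
  let ?g = "moebius a b c d"
  obtain w where w: "quasiconformal_sphere w" "\<And>z. z \<in> ball 0 1 \<Longrightarrow> w (Some z) = Some (f z)"
    and K: "kleinian_group ((\<lambda>g. w \<circ> g \<circ> inv_into UNIV w) ` G)"
    using f by (auto simp: teich_schlicht_def)
  have "inj w"
    using w(1) by (auto simp: quasiconformal_sphere_def dest!: homeomorphic_imp_injective_map)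
  have g: "?g \<in> G" "a * d - b * c = 1" using l by (auto simp: lifts_def)
  then have disc: "?g ` disc = disc" using G by (auto simp: fuchsian_group_def)
  have "w \<circ> ?g \<circ> inv_into UNIV w \<in> (\<lambda>g. w \<circ> g \<circ> inv_into UNIV w) ` G" using g by blast
  then obtain \<alpha> \<beta> \<gamma> \<delta> where m: "w \<circ> ?g \<circ> inv_into UNIV w = moebius \<alpha> \<beta> \<gamma> \<delta>"
    using obtain_lift[OF K] by metis
  have key: "\<gamma> * f z + \<delta> \<noteq> 0 \<and> f ((a * z + b) / (c * z + d)) = (\<alpha> * f z + \<beta>) / (\<gamma> * f z + \<delta>)"
    if z: "z \<in> ball 0 1" for z
  proof -
    have nz: "c * z + d \<noteq> 0" "norm (a * z + b) < norm (c * z + d)"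
      using disc_preserving_lift[OF g(2) disc] z by auto
    then have "(a * z + b) / (c * z + d) \<in> ball 0 1" by (simp add: norm_divide divide_simps)
    then have "Some (f ((a * z + b) / (c * z + d))) = w (?g (Some z))"
      using nz w(2) by (simp add: moebius_def)
    also have "\<dots> = (w \<circ> ?g \<circ> inv_into UNIV w) (w (Some z))" using \<open>inj w\<close> by simp
    also have "\<dots> = moebius \<alpha> \<beta> \<gamma> \<delta> (Some (f z))" using m w(2)[OF z] by simp
    finally show ?thesis by (auto simp: moebius_def split: if_splits)
  qed
  show ?thesis by (rule that) (use key in auto)
qed

lemma teich_schlicht_sigmaB_zero:
  assumes G: "fuchsian_first_kind G" and n: "n \<ge> 3" and f: "f \<in> teich_schlicht G"
    and sig: "\<And>z. z \<in> ball 0 1 \<Longrightarrow> sigmaB n f z = 0" and z: "z \<in> ball 0 1"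
  shows "f z = z"
proof -
  let ?B = "ball 0 1 :: complex set"
  have hol: "f holomorphic_on ?B" "inj_on f ?B" and norms: "f 0 = 0" "deriv f 0 = 1" "deriv (deriv f) 0 = 0"
    using f by (auto simp: teich_schlicht_def numeral_2_eq_2)
  obtain h P where h: "h holomorphic_on ?B" "\<And>z. z \<in> ?B \<Longrightarrow> deriv f z = (h z)\<^sup>2"
    "\<And>z. z \<in> ?B \<Longrightarrow> poly P z * h z ^ (n - 2) = 1"
    using sigmaB_zero_imp_poly[OF hol n sig] by blast
  define m where "m = n - 2"
  have m: "m > 0" using n by (simp add: m_def)
  \<comment> \<open>From \<open>P h^m = 1\<close> and f' = h^2, formally f' is the power of
    \<open>P\<close> with exponent \<open>-2/m\<close>, so its logarithmic derivative is
    \<open>\<kappa> P'/P\<close>.\<close>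
  define \<kappa> where "\<kappa> = - (2 / of_nat m :: complex)"
  have \<kappa>: "\<kappa> \<noteq> 0" "of_nat m * \<kappa> = -2" using m by (simp_all add: \<kappa>_def)
  \<comment> \<open>The numerator of the Schwarzian \<open>N1 - N^2/2\<close> over the denominator
    \<open>P^2\<close>.\<close>
  define A where "A = smult \<kappa> (P * pderiv (pderiv P) - (pderiv P)\<^sup>2) - smult (\<kappa>\<^sup>2 / 2) ((pderiv P)\<^sup>2)"
  define N where "N z = \<kappa> * poly (pderiv P) z / poly P z" for z
  define N1 where "N1 z = \<kappa> * (poly (pderiv (pderiv P)) z * poly P z - poly (pderiv P) z * poly (pderiv P) z) / (poly P z * poly P z)" for z
  have nz: "poly P z \<noteq> 0" "h z \<noteq> 0" "deriv f z \<noteq> 0" if "z \<in> ?B" for z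
  proof -
    have e: "poly P z * h z ^ m = 1" using h(3)[OF that] by (simp add: m_def)
    then show "poly P z \<noteq> 0" by auto
    show "h z \<noteq> 0" using e m by (metis mult_zero_right power_eq_0_iff zero_neq_one)
    then show "deriv f z \<noteq> 0" using h(2)[OF that] by simp
  qed
  have fd: "(f has_field_derivative deriv f z) (at z)" if "z \<in> ?B" for z
    using that hol(1) by (intro holomorphic_derivI[of _ ?B]) auto
  \<comment> \<open>Differentiating \<open>P h^m = 1\<close> and cancelling a power of
    \<open>h\<close> gives \<open>P' h = - m h' P\<close>. Multiplication by \<open>\<kappa>\<close>
    turns this into \<open>h N = 2 h'\<close>, and a further factor \<open>h\<close> gives f' N =
    f''.\<close>
  have f1d: "(deriv f has_field_derivative deriv f z * N z) (at z)" if z: "z \<in> ?B" for z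
  proof -
    have h': "(h has_field_derivative deriv h z) (at z)"
      using z h(1) by (intro holomorphic_derivI[of _ ?B]) auto
    have e1: "((\<lambda>z. poly P z * h z ^ m) has_field_derivative
        poly (pderiv P) z * h z ^ m + of_nat m * h z ^ (m - 1) * deriv h z * poly P z) (at z)"
      using DERIV_mult[OF poly_DERIV[of P z] DERIV_power[OF h', of m]] by (simp add: algebra_simps)
    have "poly (pderiv P) z * h z ^ m + of_nat m * h z ^ (m - 1) * deriv h z * poly P z = 0"
      by (rule derivatives_eq_on_open[OF open_ball z _ e1 DERIV_const[of 1]]) (simp add: h(3) m_def)
    moreover have "h z ^ m = h z * h z ^ (m - 1)" using m by (simp add: power_eq_if)
    ultimately have "h z ^ (m - 1) * (poly (pderiv P) z * h z + of_nat m * deriv h z * poly P z) = 0"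
      by (simp add: algebra_simps)
    then have "poly (pderiv P) z * h z = - of_nat m * deriv h z * poly P z"
      using nz[OF z] by (simp add: eq_neg_iff_add_eq_0)
    then have "\<kappa> * (poly (pderiv P) z * h z) = - (of_nat m * \<kappa>) * deriv h z * poly P z"
      by simp
    then have "\<kappa> * (poly (pderiv P) z * h z) = 2 * deriv h z * poly P z" unfolding \<kappa>(2) by simp
    then have "h z * N z = 2 * deriv h z" using nz[OF z] by (simp add: N_def field_simps)
    then have "deriv f z * N z = 2 * h z * deriv h z"
      using h(2)[OF z] by (simp add: power2_eq_square)
    moreover have "((\<lambda>z. (h z)\<^sup>2) has_field_derivative 2 * h z * deriv h z) (at z)"
      by (rule derivative_eq_intros h' refl)+ simp
    then have "(deriv f has_field_derivative 2 * h z * deriv h z) (at z)"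
      by (rule has_field_derivative_transform_within_open[OF _ open_ball z]) (simp add: h(2))
    ultimately show ?thesis by simp
  qed
  have Nd: "(N has_field_derivative N1 z) (at z)" if "z \<in> ?B" for z
  proof -
    have "((\<lambda>z. \<kappa> * (poly (pderiv P) z / poly P z)) has_field_derivative
      \<kappa> * ((poly (pderiv (pderiv P)) z * poly P z - poly (pderiv P) z * poly (pderiv P) z) / (poly P z * poly P z))) (at z)"
      by (intro DERIV_cmult DERIV_divide poly_DERIV nz that)
    then show ?thesis by (simp add: N_def[abs_def] N1_def)
  qed
  have T: "N1 z - (N z)\<^sup>2 / 2 = poly A z / poly (P\<^sup>2) z" if "z \<in> ?B" for z
    using nz(1)[OF that] by (simp add: N1_def N_def A_def field_simps power2_eq_square)
  have "P\<^sup>2 \<noteq> 0" using nz(1)[of 0] by auto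
  have fg: "fuchsian_group G" using G by (simp add: fuchsian_first_kind_def)
  have "A = 0"
  proof (rule fuchsian_automorphic_rational_zero[OF G \<open>P\<^sup>2 \<noteq> 0\<close>])
    fix a b c d z :: complex assume l: "(a, b, c, d) \<in> lifts G" and z: "norm z < 1"
    have det: "a * d - b * c = 1" and disc: "moebius a b c d ` disc = disc"
      using l G by (auto simp: lifts_def fuchsian_first_kind_def fuchsian_group_def)
    note D = disc_preserving_lift[OF det disc]
    have gB: "(a * z + b) / (c * z + d) \<in> ?B" if "z \<in> ?B" for z
      using D(1,2)[of z] that by (simp add: norm_divide divide_simps)
    obtain \<alpha> \<beta> \<gamma> \<delta> where conj: "\<And>z. z \<in> ?B \<Longrightarrow> \<gamma> * f z + \<delta> \<noteq> 0"
      "\<And>z. z \<in> ?B \<Longrightarrow> f ((a * z + b) / (c * z + d)) = (\<alpha> * f z + \<beta>) / (\<gamma> * f z + \<delta>)"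
      by (rule teich_schlicht_conjugation[OF fg f l], rule that)
    have zB: "z \<in> ?B" using z by simp
    have "c * u + d \<noteq> 0" if "u \<in> ?B" for u using D(1) that by simp
    note schwarzian_moebius_equivariance[where f = f and ?f1.0 = "deriv f" and N = N and ?N1.0 = N1
        and S = ?B and \<alpha> = \<alpha> and \<beta> = \<beta> and \<gamma> = \<gamma> and \<delta> = \<delta>, OF open_ball det fd f1d Nd nz(3) this gB conj zB]
    then have "poly A ((a * z + b) / (c * z + d)) / poly (P\<^sup>2) ((a * z + b) / (c * z + d))
        = (c * z + d) ^ 4 * (poly A z / poly (P\<^sup>2) z)"
      using T[OF zB] T[OF gB[OF zB]] by simp
    then show "poly A ((a * z + b) / (c * z + d)) * poly (P\<^sup>2) z
        = (c * z + d) ^ 4 * poly A z * poly (P\<^sup>2) ((a * z + b) / (c * z + d))"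
      using nz(1)[OF zB] nz(1)[OF gB[OF zB]] by (simp add: frac_eq_eq)
  qed
  \<comment> \<open>Vanishing of the Schwarzian becomes a differential equation for \<open>P\<close>
    after division by \<open>\<kappa>\<close>.\<close>
  have "smult \<kappa> (P * pderiv (pderiv P)) = smult \<kappa> (smult (1 + \<kappa> / 2) ((pderiv P)\<^sup>2))"
    using \<open>A = 0\<close> unfolding A_def by (simp add: algebra_simps smult_diff_right smult_add_left smult_add_right power2_eq_square)
  then have ode: "P * pderiv (pderiv P) = smult (1 + \<kappa> / 2) ((pderiv P)\<^sup>2)"
    using \<kappa>(1) by (metis smult_eq_iff)
  \<comment> \<open>The normalization f''(0) = 0 enters here: it says \<open>P'(0) = 0\<close>,
    which excludes nonconstant solutions of \<open>ode\<close>.\<close>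
  have "deriv (deriv f) 0 = deriv f 0 * N 0" using f1d[of 0] by (simp add: DERIV_imp_deriv)
  then have "poly (pderiv P) 0 = 0" using norms nz(1)[of 0] \<kappa> by (simp add: N_def)
  then have "pderiv P = 0" using pderiv_zero_of_ode[OF ode] nz(1)[of 0] by simp
  then have "N z = 0" for z by (simp add: N_def)
  then have "(deriv f has_field_derivative 0) (at z within ?B)" if "z \<in> ?B" for z
    using f1d[OF that] by (auto intro: has_field_derivative_at_within)
  then obtain e where "deriv f z = e" if "z \<in> ?B" for z
    using has_field_derivative_zero_constant[of ?B "deriv f"] by auto
  then have "deriv f z = 1" if "z \<in> ?B" for z using that norms(2) by (metis centre_in_ball zero_less_one)
  then have "((\<lambda>z. f z - z) has_field_derivative 0) (at z within ?B)" if "z \<in> ?B" for z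
    using fd[OF that] that
    by (auto intro!: derivative_eq_intros intro: has_field_derivative_at_within)
  then obtain e where e: "\<And>z. z \<in> ?B \<Longrightarrow> f z - z = e"
    using has_field_derivative_zero_constant[of ?B "\<lambda>z. f z - z"] by auto
  then show ?thesis using e[of 0] e[OF z] norms(1) by simp
qed

section \<open>Quasiconformality of conformal maps\<close>

lemma abs_cont_on_Lipschitz:
  fixes g :: "real \<Rightarrow> complex"
  assumes "\<And>x y. x \<in> S \<Longrightarrow> y \<in> S \<Longrightarrow> norm (g x - g y) \<le> L * \<bar>x - y\<bar>"
  shows "abs_cont_on S g"
  unfolding abs_cont_on_def
proof (intro allI impI)
  fix \<epsilon> :: real assume \<epsilon>: "\<epsilon> > 0"
  \<comment> \<open>Enlarging \<open>L\<close> gives a positive constant by which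
    \<open>\<epsilon>\<close> can be divided.\<close>
  define B where "B = \<bar>L\<bar> + 1"
  have B: "B > 0" "L \<le> B" by (auto simp: B_def)
  show "\<exists>\<delta>>0. \<forall>\<D>. \<D> division_of \<Union>\<D> \<and> \<Union>\<D> \<subseteq> S \<and> (\<Sum>K\<in>\<D>. Sup K - Inf K) < \<delta> \<longrightarrow>
     (\<Sum>K\<in>\<D>. norm (g (Sup K) - g (Inf K))) < \<epsilon>"
  proof (intro exI[of _ "\<epsilon> / B"] conjI allI impI)
    fix \<D> assume D: "\<D> division_of \<Union>\<D> \<and> \<Union>\<D> \<subseteq> S \<and> (\<Sum>K\<in>\<D>. Sup K - Inf K) < \<epsilon> / B"
    have "norm (g (Sup K) - g (Inf K)) \<le> B * (Sup K - Inf K)" if K: "K \<in> \<D>" for K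
    proof -
      obtain u v where uv: "K = {u..v}" "K \<noteq> {}" "K \<subseteq> S"
        using D K by (metis Sup_upper box_real(2) division_ofD(3,4) order_trans)
      then have "norm (g (Sup K) - g (Inf K)) \<le> L * \<bar>Sup K - Inf K\<bar>" by (intro assms) auto
      also have "\<dots> \<le> B * (Sup K - Inf K)" using B uv by (auto intro!: mult_right_mono)
      finally show ?thesis .
    qed
    then have "(\<Sum>K\<in>\<D>. norm (g (Sup K) - g (Inf K))) \<le> B * (\<Sum>K\<in>\<D>. Sup K - Inf K)"
      unfolding sum_distrib_left by (rule sum_mono)
    also have "\<dots> < \<epsilon>" using D B by (simp add: field_simps)
    finally show "(\<Sum>K\<in>\<D>. norm (g (Sup K) - g (Inf K))) < \<epsilon>" .
  qed (use \<epsilon> B in auto)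
qed

text \<open>The derivative is bounded on a compact rectangle, and rectangles are convex, so
  \<open>F\<close> is Lipschitz there. Absolute continuity thus holds on every horizontal and
  vertical segment.\<close>

lemma holomorphic_imp_ACL_on:
  assumes F: "F holomorphic_on S" and S: "open S"
  shows "ACL_on S F"
  unfolding ACL_on_def
proof (intro allI impI)
  fix a b :: complex assume ab: "cbox a b \<subseteq> S"
  have "deriv F holomorphic_on S" using F S by (rule holomorphic_deriv)
  then have "continuous_on (cbox a b) (deriv F)"
    using ab holomorphic_on_imp_continuous_on holomorphic_on_subset by blast
  then have "bounded (deriv F ` cbox a b)"
    by (intro compact_imp_bounded compact_continuous_image compact_cbox)
  then obtain B where B: "\<And>z. z \<in> cbox a b \<Longrightarrow> norm (deriv F z) \<le> B"
    by (auto simp: bounded_iff)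
  have L: "norm (F u - F v) \<le> B * norm (u - v)" if "u \<in> cbox a b" "v \<in> cbox a b" for u v
  proof (rule field_differentiable_bound[OF convex_box(1) _ B that])
    show "(F has_field_derivative deriv F z) (at z within cbox a b)" if "z \<in> cbox a b" for z
      using that ab holomorphic_derivI[OF F S] by (blast intro: has_field_derivative_at_within)
  qed
  have "abs_cont_on {Re a..Re b} (\<lambda>x. F (Complex x y))" if "y \<in> {Im a..Im b}" for y
  proof (rule abs_cont_on_Lipschitz)
    fix u v assume "u \<in> {Re a..Re b}" "v \<in> {Re a..Re b}"
    then have "norm (F (Complex u y) - F (Complex v y)) \<le> B * norm (Complex u y - Complex v y)"
      using that by (intro L) (auto simp: in_cbox_complex_iff)
    also have "norm (Complex u y - Complex v y) = \<bar>u - v\<bar>" by (simp add: cmod_def)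
    finally show "norm (F (Complex u y) - F (Complex v y)) \<le> B * \<bar>u - v\<bar>" .
  qed
  moreover have "abs_cont_on {Im a..Im b} (\<lambda>y. F (Complex x y))" if "x \<in> {Re a..Re b}" for x
  proof (rule abs_cont_on_Lipschitz)
    fix u v assume "u \<in> {Im a..Im b}" "v \<in> {Im a..Im b}"
    then have "norm (F (Complex x u) - F (Complex x v)) \<le> B * norm (Complex x u - Complex x v)"
      using that by (intro L) (auto simp: in_cbox_complex_iff)
    also have "norm (Complex x u - Complex x v) = \<bar>u - v\<bar>" by (simp add: cmod_def)
    finally show "norm (F (Complex x u) - F (Complex x v)) \<le> B * \<bar>u - v\<bar>" .
  qed
  ultimately show "(AE y in lborel. y \<in> {Im a..Im b} \<longrightarrow> abs_cont_on {Re a..Re b} (\<lambda>x. F (Complex x y))) \<and>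
     (AE x in lborel. x \<in> {Re a..Re b} \<longrightarrow> abs_cont_on {Im a..Im b} (\<lambda>y. F (Complex x y)))"
    by simp
qed

text \<open>The Cauchy-Riemann equation: by the chain rule the partial derivatives are
  \<open>F'\<close> and \<open>\<i> * F'\<close>.\<close>

lemma d_zbar_holomorphic:
  assumes "(F has_field_derivative F') (at z)"
  shows "d_zbar F z = 0"
proof -
  have "((\<lambda>x. Complex x (Im z)) has_vector_derivative 1) (at (Re z))"
    unfolding Complex_eq by (auto intro!: derivative_eq_intros simp: has_vector_derivative_def scaleR_conv_of_real)
  then have "((\<lambda>x. F (Complex x (Im z))) has_vector_derivative 1 * F') (at (Re z))"
    using field_vector_diff_chain_at[of "\<lambda>x. Complex x (Im z)" 1 "Re z" F F'] assms by (simp add: o_def)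
  then have x: "partial_x F z = F'" by (simp add: partial_x_def vector_derivative_at)
  have "((\<lambda>y. Complex (Re z) y) has_vector_derivative \<i>) (at (Im z))"
    unfolding Complex_eq by (auto intro!: derivative_eq_intros simp: has_vector_derivative_def scaleR_conv_of_real mult.commute)
  then have "((\<lambda>y. F (Complex (Re z) y)) has_vector_derivative \<i> * F') (at (Im z))"
    using field_vector_diff_chain_at[of "\<lambda>y. Complex (Re z) y" \<i> "Im z" F F'] assms by (simp add: o_def)
  then have "partial_y F z = \<i> * F'" by (simp add: partial_y_def vector_derivative_at)
  then show ?thesis using x by (simp add: d_zbar_def)
qed

text \<open>The dilatation is 0 because \<open>d_zbar\<close> vanishes; continuity of the inverse is
  invariance of domain.\<close>

lemma conformal_imp_quasiconformal_on:
  assumes F: "F holomorphic_on S" and S: "open S" and inj: "inj_on F S"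
  shows "quasiconformal_on 0 S F"
  unfolding quasiconformal_on_def
proof (intro conjI)
  show "\<exists>g. homeomorphism S (F ` S) F g"
    using invariance_of_domain_homeomorphism[OF S holomorphic_on_imp_continuous_on[OF F] _ inj] by auto
  show "AE z in lebesgue. z \<in> S \<longrightarrow> norm (d_zbar F z) \<le> 0 * norm (d_z F z)"
    using d_zbar_holomorphic[OF holomorphic_derivI[OF F S]] by simp
qed (use S holomorphic_imp_ACL_on[OF F S] in auto)

lemma quasiconformal_sphere_id: "quasiconformal_sphere id"
  unfolding quasiconformal_sphere_def
proof (intro conjI exI[of _ "0::real"])
  have id: "quasiconformal_on 0 UNIV (\<lambda>z. z)"
    by (intro conformal_imp_quasiconformal_on) auto
  have inv: "quasiconformal_on 0 (- {0}) (\<lambda>z. the (if z = 0 then None else Some (1 / z)))"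
  proof (rule conformal_imp_quasiconformal_on)
    have "(\<lambda>z. 1 / z) holomorphic_on (- {0 :: complex})" by (intro holomorphic_intros) auto
    then show "(\<lambda>z. the (if z = 0 then None else Some (1 / z))) holomorphic_on - {0 :: complex}"
      by (rule holomorphic_transform) auto
  qed (auto simp: inj_on_def)
  \<comment> \<open>The inversion is an involution, so equal charts give the identity of the plane
    and different charts give \<open>1 / z\<close> off 0.\<close>
  have eqs: "{z. sphere_inversion (Some z) \<noteq> None} = - {0}" "sphere_inversion (sphere_inversion (Some z)) = Some z" for z
    by (auto simp: sphere_inversion_def)
  show "\<forall>\<phi>\<in>{id, sphere_inversion}. \<forall>\<psi>\<in>{id, sphere_inversion}.
        quasiconformal_on 0 {z. \<psi> (id (\<phi> (Some z))) \<noteq> None} (\<lambda>z. the (\<psi> (id (\<phi> (Some z)))))"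
    using id inv eqs by (simp add: sphere_inversion_def)
qed auto

section \<open>The identity as a point of the Teichmueller space\<close>

lemma deriv_restrict_id:
  fixes z :: complex
  assumes "z \<in> ball 0 1"
  shows "deriv (\<lambda>z\<in>ball 0 1. z) z = 1"
proof -
  have "\<forall>\<^sub>F u in nhds z. (\<lambda>z\<in>ball 0 1. z) u = u"
    using assms by (intro eventually_nhds_in_open[THEN eventually_mono, of "ball 0 1"]) auto
  \<comment> \<open>The restricted function is \<open>undefined\<close> off the disc, but the
    derivative depends only on values near \<open>z\<close>.\<close>
  then have "deriv (\<lambda>z\<in>ball 0 1. z) z = deriv (\<lambda>u. u) z" by (rule deriv_cong_ev) simp
  then show ?thesis by simp
qed

text \<open>The quasiconformal extension is \<open>id\<close>, for which the conjugated group is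
  \<open>G\<close> itself.\<close>

lemma restrict_id_in_teich_schlicht:
  assumes "kleinian_group G"
  shows "(\<lambda>z\<in>ball 0 1. z) \<in> teich_schlicht G"
proof -
  let ?f = "\<lambda>z\<in>ball 0 1. z :: complex"
  note d = deriv_restrict_id
  have "deriv (deriv ?f) 0 = deriv (\<lambda>u. 1) 0"
  proof (rule deriv_cong_ev)
    show "\<forall>\<^sub>F u in nhds 0. deriv ?f u = 1"
      using d by (intro eventually_nhds_in_open[THEN eventually_mono, of "ball 0 1"]) auto
  qed simp
  then have "(deriv ^^ 2) ?f 0 = 0" by (simp add: numeral_2_eq_2)
  moreover have "?f holomorphic_on ball 0 1"
    by (rule holomorphic_transform[of "\<lambda>z. z"]) auto
  moreover have "(\<lambda>g. id \<circ> g \<circ> inv_into UNIV id) ` G = G" by simp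
  ultimately show ?thesis
    using d[of 0] quasiconformal_sphere_id assms unfolding teich_schlicht_def
    by (auto simp: inj_on_def intro!: exI[of _ id])
qed

text \<open>With the constant branch 1, a constant is differentiated \<open>n - 1 \<ge> 1\<close>
  times.\<close>

lemma sigmaB_restrict_id:
  assumes n: "n \<ge> 2" and z: "z \<in> ball 0 1"
  shows "sigmaB n (\<lambda>z\<in>ball 0 1. z) z = 0"
proof -
  let ?f = "\<lambda>z\<in>ball 0 1. z :: complex"
  note d = deriv_restrict_id
  have "sqrt_branch ?f z (\<lambda>_. 1)"
    unfolding sqrt_branch_def
    using d z by (auto intro!: eventually_nhds_in_open[THEN eventually_mono, of "ball 0 1"])
  then show ?thesis using sigmaB_eq[of ?f z "\<lambda>_. 1" n] d[OF z] n by (simp add: higher_deriv_const)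
qed

theorem theorem4p28:
  fixes G :: "(complex option \<Rightarrow> complex option) set" and n :: nat
  assumes "fuchsian_first_kind G" and "n \<ge> 3"
  shows "{f. \<forall>z\<in>ball 0 1. sigmaB n f z = 0} \<inter> teich_schlicht G = {\<lambda>z\<in>ball 0 1. z}"
proof (intro equalityI subsetI)
  fix f assume f: "f \<in> {f. \<forall>z\<in>ball 0 1. sigmaB n f z = 0} \<inter> teich_schlicht G"
  \<comment> \<open>Extensionality turns agreement on the disc into equality of functions.\<close>
  then have "f \<in> extensional (ball 0 1)" by (auto simp: teich_schlicht_def)
  moreover have "f z = z" if "z \<in> ball 0 1" for z
    using teich_schlicht_sigmaB_zero[OF assms, of f z] f that by auto
  ultimately show "f \<in> {\<lambda>z\<in>ball 0 1. z}" by (auto intro: extensionalityI)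
next
  fix f :: "complex \<Rightarrow> complex" assume "f \<in> {\<lambda>z\<in>ball 0 1. z}"
  then show "f \<in> {f. \<forall>z\<in>ball 0 1. sigmaB n f z = 0} \<inter> teich_schlicht G"
    using assms restrict_id_in_teich_schlicht[of G] sigmaB_restrict_id[of n]
    by (auto simp: fuchsian_first_kind_def fuchsian_group_def)
qed

end
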